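(* Any 3rd order odd ODE $\xi'''=\mathfrak G(x,\xi,\xi',\xi'')$ has contact symmetry superalgebra of dimension at most $(4|4)$ (i.e. even part of dimension at most $4$ and odd part of dimension at most $4$), and this bound is sharp.
   Context: Here $\xi$ is an odd function of the even real variable $x$, and $\mathfrak G$ is an odd superfunction. The ODE is encoded by the supermanifold $M=\mathbb R^{1|3}$ with coordinates $(x\,|\,\xi,\xi',\xi'')$ ($x$ even; $\xi,\xi',\xi''$ odd) and the distribution $C=E\oplus V\subset TM$, where $E=\langle\partial_x+\xi'\partial_\xi+\xi''\partial_{\xi'}+\mathfrak G\,\partial_{\xi''}\rangle$ is of rank $(1|0)$ and $V=\langle\partial_{\xi''}\rangle$ is of rank $(0|1)$. The contact symmetry superalgebra of the ODE is the Lie superalgebra of supervector fields $X$ with $\mathcal L_XE\subset E$ and $\mathcal L_XV\subset V$. *)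

theory Defs
  imports "HOL-Analysis.Analysis" "HOL-Library.Function_Algebras"
begin

section \<open>Smooth functions on the real line\<close>

definition smooth :: "(real \<Rightarrow> real) \<Rightarrow> bool" where
  "smooth f \<longleftrightarrow> (\<forall>n x. (deriv ^^ n) f field_differentiable (at x))"

definition ndiff :: "nat \<Rightarrow> (real \<Rightarrow> real) \<Rightarrow> bool" where
  "ndiff n f \<longleftrightarrow> (\<forall>k\<le>n. \<forall>x. (deriv ^^ k) f field_differentiable (at x))"

lemma smooth_iff_ndiff: "smooth f \<longleftrightarrow> (\<forall>n. ndiff n f)"
  unfolding smooth_def ndiff_def by auto

lemma ndiff_0: "ndiff 0 f \<longleftrightarrow> (\<forall>x. f field_differentiable (at x))"
  by (simp add: ndiff_def)

lemma ndiff_Suc: "ndiff (Suc n) f \<longleftrightarrow> (\<forall>x. f field_differentiable (at x)) \<and> ndiff n (deriv f)"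
proof -
  have "(\<forall>k\<le>Suc n. P k) \<longleftrightarrow> P 0 \<and> (\<forall>k\<le>n. P (Suc k))" for P :: "nat \<Rightarrow> bool"
    by (metis Suc_le_mono not0_implies_Suc zero_le)
  then show ?thesis
    unfolding ndiff_def by (simp add: funpow_swap1 del: funpow.simps(2) add: funpow_Suc_right)
qed

lemma ndiff_differentiable: "ndiff n f \<Longrightarrow> f field_differentiable (at x)"
  by (cases n) (auto simp: ndiff_0 ndiff_Suc)

lemma ndiff_SucD: "ndiff (Suc n) f \<Longrightarrow> ndiff n f"
  by (simp add: ndiff_def)

lemma ndiff_add: "ndiff n f \<Longrightarrow> ndiff n g \<Longrightarrow> ndiff n (\<lambda>x. f x + g x)"
proof (induction n arbitrary: f g)
  case 0
  then show ?case by (auto simp: ndiff_0 intro: field_differentiable_add)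
next
  case (Suc n)
  then have "deriv (\<lambda>x. f x + g x) = (\<lambda>x. deriv f x + deriv g x)"
    by (auto simp: ndiff_Suc)
  with Suc show ?case by (auto simp: ndiff_Suc intro: field_differentiable_add)
qed

lemma ndiff_mult: "ndiff n f \<Longrightarrow> ndiff n g \<Longrightarrow> ndiff n (\<lambda>x. f x * g x)"
proof (induction n arbitrary: f g)
  case 0
  then show ?case by (auto simp: ndiff_0 intro: field_differentiable_mult)
next
  case (Suc n)
  then have d: "deriv (\<lambda>x. f x * g x) = (\<lambda>x. f x * deriv g x + deriv f x * g x)"
    by (auto simp: ndiff_Suc)
  have "ndiff n f" "ndiff n g"
    using Suc.prems by (auto dest: ndiff_SucD)
  moreover have "ndiff n (deriv f)" "ndiff n (deriv g)"
    using Suc.prems by (auto simp: ndiff_Suc)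
  ultimately have "ndiff n (deriv (\<lambda>x. f x * g x))"
    unfolding d by (intro ndiff_add Suc.IH)
  with Suc.prems show ?case by (auto simp: ndiff_Suc intro: field_differentiable_mult)
qed

lemma smooth_const [simp]: "smooth (\<lambda>_. c)"
proof -
  have "ndiff n (\<lambda>_. c)" for n
    by (induction n arbitrary: c) (simp_all add: ndiff_0 ndiff_Suc)
  then show ?thesis by (simp add: smooth_iff_ndiff)
qed

lemma smooth_ident [simp]: "smooth (\<lambda>x. x)"
proof -
  have "ndiff n (\<lambda>x. x)" for n
    using smooth_const[of 1, unfolded smooth_iff_ndiff]
    by (cases n) (simp_all add: ndiff_0 ndiff_Suc field_differentiable_ident)
  then show ?thesis by (simp add: smooth_iff_ndiff)
qed

lemma smooth_add: "smooth f \<Longrightarrow> smooth g \<Longrightarrow> smooth (\<lambda>x. f x + g x)"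
  by (simp add: smooth_iff_ndiff ndiff_add)

lemma smooth_mult: "smooth f \<Longrightarrow> smooth g \<Longrightarrow> smooth (\<lambda>x. f x * g x)"
  by (simp add: smooth_iff_ndiff ndiff_mult)

lemma smooth_cmult: "smooth f \<Longrightarrow> smooth (\<lambda>x. c * f x)"
  by (intro smooth_mult) simp_all

lemma smooth_uminus: "smooth f \<Longrightarrow> smooth (\<lambda>x. - f x)"
  using smooth_cmult[of f "-1"] by simp

lemma smooth_diff: "smooth f \<Longrightarrow> smooth g \<Longrightarrow> smooth (\<lambda>x. f x - g x)"
  using smooth_add[of f "\<lambda>x. - g x"] by (simp add: smooth_uminus)

lemma smooth_sum: "(\<And>i. i \<in> A \<Longrightarrow> smooth (f i)) \<Longrightarrow> smooth (\<lambda>x. \<Sum>i\<in>A. f i x)"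
  by (induction A rule: infinite_finite_induct) (auto intro: smooth_add)

lemma smooth_deriv: "smooth f \<Longrightarrow> smooth (deriv f)"
  by (simp add: smooth_iff_ndiff) (metis ndiff_Suc)


section \<open>The superalgebra of superfunctions on the supermanifold of dimension (1|3)\<close>

text \<open>
  The odd coordinates \<open>\<xi>, \<xi>', \<xi>''\<close> are numbered \<open>0, 1, 2\<close>.  A superfunction is
  \<open>\<Sum>\<^sub>I f\<^sub>I(x) \<xi>\<^sub>I\<close> where \<open>I\<close> ranges over the subsets of \<open>{0,1,2}\<close>, \<open>\<xi>\<^sub>I\<close> is the product
  of the \<open>\<xi>\<^sub>i\<close> (\<open>i \<in> I\<close>) in increasing order, and the \<open>f\<^sub>I\<close> are smooth real functions.
\<close>

typedef superfun =
  "{f :: nat set \<Rightarrow> real \<Rightarrow> real.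
     (\<forall>I. smooth (f I)) \<and> (\<forall>I. \<not> I \<subseteq> {0,1,2} \<longrightarrow> f I = (\<lambda>_. 0))}"
  morphisms component Superfun
  by (rule exI[of _ "\<lambda>_ _. 0"]) simp

setup_lifting type_definition_superfun

text \<open>\<open>\<xi>\<^sub>I \<xi>\<^sub>J = koszul I J \<cdot> \<xi>\<^sub>I\<^sub>\<union>\<^sub>J\<close> for disjoint \<open>I\<close>, \<open>J\<close>.\<close>

definition koszul :: "nat set \<Rightarrow> nat set \<Rightarrow> real" where
  "koszul I J = (-1) ^ card {(i, j) \<in> I \<times> J. j < i}"

lemma koszul_empty [simp]: "koszul {} J = 1" "koszul I {} = 1"
  by (simp_all add: koszul_def)

lemma koszul_Un_left:
  assumes "finite I" "finite J" "finite K" "I \<inter> J = {}"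
  shows "koszul (I \<union> J) K = koszul I K * koszul J K"
proof -
  have "{(i, j) \<in> (I \<union> J) \<times> K. j < i} = {(i, j) \<in> I \<times> K. j < i} \<union> {(i, j) \<in> J \<times> K. j < i}"
    by auto
  moreover have "finite {(i, j) \<in> I \<times> K. j < i}" "finite {(i, j) \<in> J \<times> K. j < i}"
    using assms by (auto intro: finite_subset[of _ "I \<times> K"] finite_subset[of _ "J \<times> K"])
  moreover have "{(i, j) \<in> I \<times> K. j < i} \<inter> {(i, j) \<in> J \<times> K. j < i} = {}"
    using assms by auto
  ultimately show ?thesis
    by (simp add: koszul_def card_Un_disjoint power_add)
qed

lemma koszul_Un_right:
  assumes "finite I" "finite J" "finite K" "J \<inter> K = {}"
  shows "koszul I (J \<union> K) = koszul I J * koszul I K"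
proof -
  have "{(i, j) \<in> I \<times> (J \<union> K). j < i} = {(i, j) \<in> I \<times> J. j < i} \<union> {(i, j) \<in> I \<times> K. j < i}"
    by auto
  moreover have "finite {(i, j) \<in> I \<times> J. j < i}" "finite {(i, j) \<in> I \<times> K. j < i}"
    using assms by (auto intro: finite_subset[of _ "I \<times> J"] finite_subset[of _ "I \<times> K"])
  moreover have "{(i, j) \<in> I \<times> J. j < i} \<inter> {(i, j) \<in> I \<times> K. j < i} = {}"
    using assms by auto
  ultimately show ?thesis
    by (simp add: koszul_def card_Un_disjoint power_add)
qed

instantiation superfun :: real_algebra_1
begin

lift_definition zero_superfun :: superfun is "\<lambda>_ _. 0" by simp

lift_definition one_superfun :: superfun is "\<lambda>I _. if I = {} then 1 else 0" by simp

lift_definition plus_superfun :: "superfun \<Rightarrow> superfun \<Rightarrow> superfun"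
  is "\<lambda>f g I x. f I x + g I x" by (simp add: smooth_add)

lift_definition minus_superfun :: "superfun \<Rightarrow> superfun \<Rightarrow> superfun"
  is "\<lambda>f g I x. f I x - g I x" by (simp add: smooth_diff)

lift_definition uminus_superfun :: "superfun \<Rightarrow> superfun"
  is "\<lambda>f I x. - f I x" by (simp add: smooth_uminus)

lift_definition scaleR_superfun :: "real \<Rightarrow> superfun \<Rightarrow> superfun"
  is "\<lambda>c f I x. c * f I x" by (simp add: smooth_cmult)

lift_definition times_superfun :: "superfun \<Rightarrow> superfun \<Rightarrow> superfun"
  is "\<lambda>f g K x. \<Sum>I\<in>Pow K. koszul I (K - I) * f I x * g (K - I) x"
proof (intro conjI allI impI, goal_cases)
  case (1 f g K)
  then show ?case by (intro smooth_sum smooth_mult) simp_all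
next
  case (2 f g K)
  have "f I x * g (K - I) x = 0" if "I \<in> Pow K" for I x
  proof (cases "I \<subseteq> {0,1,2}")
    case True
    then have "\<not> K - I \<subseteq> {0,1,2}" using \<open>\<not> K \<subseteq> {0,1,2}\<close> by blast
    then show ?thesis using 2 by simp
  qed (use 2 in simp)
  then show ?case by (intro ext sum.neutral) (simp add: mult.assoc)
qed

instance
proof
  fix f g h :: superfun and a b :: real
  show "f * g * h = f * (g * h)"
  proof (transfer, intro ext)
    fix f g h :: "nat set \<Rightarrow> real \<Rightarrow> real" and K x
    show "(\<Sum>L\<in>Pow K. koszul L (K - L) *
            (\<Sum>I\<in>Pow L. koszul I (L - I) * f I x * g (L - I) x) * h (K - L) x) =
          (\<Sum>I\<in>Pow K. koszul I (K - I) * f I x *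
            (\<Sum>J\<in>Pow (K - I). koszul J (K - I - J) * g J x * h (K - I - J) x))"
      (is "?lhs = ?rhs")
    proof (cases "finite K")
      case True
      have fin: "finite A" if "A \<subseteq> K" for A using that True by (rule finite_subset)
      have "?lhs = (\<Sum>(L, I)\<in>Sigma (Pow K) Pow. koszul L (K - L) *
              (koszul I (L - I) * f I x * g (L - I) x) * h (K - L) x)"
        using True fin by (subst sum.Sigma[symmetric]) (auto simp: sum_distrib_left sum_distrib_right)
      also have "\<dots> = (\<Sum>(I, J)\<in>Sigma (Pow K) (\<lambda>I. Pow (K - I)). koszul I (K - I) * f I x *
              (koszul J (K - I - J) * g J x * h (K - I - J) x))"
      proof (rule sum.reindex_bij_witness[where i = "\<lambda>(I, J). (I \<union> J, I)"
                and j = "\<lambda>(L, I). (I, L - I)"], goal_cases)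
        case (5 a)
        obtain L I where a: "a = (L, I)" "L \<subseteq> K" "I \<subseteq> L" using 5 by auto
        define J where "J = L - I"
        define M where "M = K - L"
        have L: "L = I \<union> J" and K: "K - I = J \<union> M" "K - I - J = M"
          using a by (auto simp: J_def M_def)
        have dis: "I \<inter> J = {}" "J \<inter> M = {}" by (auto simp: J_def M_def a)
        have f: "finite I" "finite J" "finite M"
          using a by (auto intro!: fin simp: J_def M_def)
        have 1: "koszul L M = koszul I M * koszul J M"
          unfolding L by (rule koszul_Un_left[OF f dis(1)])
        have 2: "koszul I (K - I) = koszul I J * koszul I M"
          unfolding K by (rule koszul_Un_right[OF f dis(2)])
        show ?case
          by (simp only: a(1) prod.case K(2) J_def[symmetric] M_def[symmetric] 1 2) (simp add: mult_ac)
      qed auto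
      also have "\<dots> = ?rhs"
        using True fin by (subst sum.Sigma[symmetric]) (auto simp: sum_distrib_left sum_distrib_right)
      finally show ?thesis .
    qed (simp add: sum.infinite finite_Pow_iff)
  qed
  show "(f + g) * h = f * h + g * h"
    by (transfer, intro ext) (simp add: algebra_simps sum.distrib)
  show "f * (g + h) = f * g + f * h"
    by (transfer, intro ext) (simp add: algebra_simps sum.distrib)
  show "1 * f = f"
  proof (transfer, intro ext, elim conjE)
    fix f :: "nat set \<Rightarrow> real \<Rightarrow> real" and K x
    assume *: "\<forall>I. \<not> I \<subseteq> {0, 1, 2} \<longrightarrow> f I = (\<lambda>_. 0)"
    show "(\<Sum>I\<in>Pow K. koszul I (K - I) * (if I = {} then 1 else 0) * f (K - I) x) = f K x"
    proof (cases "finite K")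
      case True
      have "(\<Sum>I\<in>Pow K. koszul I (K - I) * (if I = {} then 1 else 0) * f (K - I) x) =
            (\<Sum>I\<in>Pow K. if I = {} then f K x else 0)"
        by (rule sum.cong) auto
      with True show ?thesis by simp
    next
      case False
      then have "\<not> K \<subseteq> {0,1,2}" using finite_subset by blast
      with False * show ?thesis by (simp add: sum.infinite finite_Pow_iff)
    qed
  qed
  show "f * 1 = f"
  proof (transfer, intro ext, elim conjE)
    fix f :: "nat set \<Rightarrow> real \<Rightarrow> real" and K x
    assume *: "\<forall>I. \<not> I \<subseteq> {0, 1, 2} \<longrightarrow> f I = (\<lambda>_. 0)"
    show "(\<Sum>I\<in>Pow K. koszul I (K - I) * f I x * (if K - I = {} then 1 else 0)) = f K x"
    proof (cases "finite K")
      case True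
      have "(\<Sum>I\<in>Pow K. koszul I (K - I) * f I x * (if K - I = {} then 1 else 0)) =
            (\<Sum>I\<in>Pow K. if I = K then f K x else 0)"
        by (rule sum.cong) auto
      with True show ?thesis by simp
    next
      case False
      then have "\<not> K \<subseteq> {0,1,2}" using finite_subset by blast
      with False * show ?thesis by (simp add: sum.infinite finite_Pow_iff)
    qed
  qed
  show "a *\<^sub>R f * g = a *\<^sub>R (f * g)"
    by (transfer, intro ext) (simp add: sum_distrib_left mult_ac)
  show "f * a *\<^sub>R g = a *\<^sub>R (f * g)"
    by (transfer, intro ext) (simp add: sum_distrib_left mult_ac)
  show "(0::superfun) \<noteq> 1"
    by transfer (auto simp: fun_eq_iff)
qed (transfer; simp add: algebra_simps fun_eq_iff)+

end

text \<open>Parities are natural numbers read modulo 2.  The zero superfunction has both parities.\<close>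

definition homogeneous :: "nat \<Rightarrow> superfun \<Rightarrow> bool" where
  "homogeneous p f \<longleftrightarrow> (\<forall>I. component f I \<noteq> (\<lambda>_. 0) \<longrightarrow> even (card I + p))"

abbreviation odd_superfun :: "superfun \<Rightarrow> bool" where
  "odd_superfun \<equiv> homogeneous 1"

lift_definition parity_part :: "nat \<Rightarrow> superfun \<Rightarrow> superfun"
  is "\<lambda>p f I x. if even (card I + p) then f I x else 0"
proof (intro conjI allI impI, goal_cases)
  case (1 p f I)
  then show ?case by (cases "even (card I + p)") (simp_all only: if_True if_False smooth_const)
next
  case (2 p f I)
  then have "f I = (\<lambda>_. 0)" by metis
  then show ?case by (simp add: fun_eq_iff)
qed

lift_definition xi :: "nat \<Rightarrow> superfun"
  is "\<lambda>k I _. if I = {k} \<and> k \<le> 2 then 1 else 0" by auto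

lift_definition partial_x :: "superfun \<Rightarrow> superfun"
  is "\<lambda>f I. deriv (f I)" by (auto simp: smooth_deriv)

text \<open>
  The left derivative: moving \<open>\<xi>\<^sub>k\<close> to the front of \<open>\<xi>\<^sub>I\<close>, \<open>k \<in> I\<close>, produces the sign
  \<open>(-1)\<^sup>m\<close> where \<open>m\<close> is the number of elements of \<open>I\<close> below \<open>k\<close>.
\<close>

lift_definition partial_xi :: "nat \<Rightarrow> superfun \<Rightarrow> superfun"
  is "\<lambda>k f J x. if k \<in> J then 0 else (-1) ^ card {i \<in> J. i < k} * f (insert k J) x"
proof (intro conjI allI impI, goal_cases)
  case (1 k f J)
  then show ?case by (cases "k \<in> J") (auto intro: smooth_cmult)
next
  case (2 k f J)
  then have "\<not> insert k J \<subseteq> {0,1,2}" by blast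
  with 2 have "f (insert k J) = (\<lambda>_. 0)" by metis
  then show ?case by (simp add: fun_eq_iff)
qed


section \<open>Supervector fields\<close>

text \<open>The pointwise vector space structure, so that \<open>span\<close> and \<open>dim\<close> apply to operators on superfunctions.\<close>

instantiation "fun" :: (type, real_vector) real_vector
begin

definition scaleR_fun :: "real \<Rightarrow> ('a \<Rightarrow> 'b) \<Rightarrow> 'a \<Rightarrow> 'b" where
  "scaleR_fun c A = (\<lambda>x. c *\<^sub>R A x)"

instance
  by standard (simp_all add: scaleR_fun_def fun_eq_iff scaleR_add_right scaleR_add_left)

end

type_synonym operator = "superfun \<Rightarrow> superfun"

definition superderivation :: "nat \<Rightarrow> operator \<Rightarrow> bool" where
  "superderivation p X \<longleftrightarrow>
     linear X \<and>
     (\<forall>q f. homogeneous q f \<longrightarrow> homogeneous (p + q) (X f)) \<and>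
     (\<forall>q f g. homogeneous q f \<longrightarrow> X (f * g) = X f * g + (-1) ^ (p * q) * f * X g)"

definition supervector_fields :: "operator set" where
  "supervector_fields = {X + Y | X Y. superderivation 0 X \<and> superderivation 1 Y}"

definition operator_part :: "nat \<Rightarrow> operator \<Rightarrow> operator" where
  "operator_part p A = (\<lambda>f. \<Sum>q<2. parity_part (p + q) (A (parity_part q f)))"

text \<open>
  The bilinear extension of \<open>[X,Y] = X \<circ> Y - (-1)\<^sup>p\<^sup>q Y \<circ> X\<close> for \<open>X\<close>, \<open>Y\<close> of
  parities \<open>p\<close>, \<open>q\<close>; it is also the Lie derivative of \<open>Y\<close> along \<open>X\<close>.
\<close>

definition superbracket :: "operator \<Rightarrow> operator \<Rightarrow> operator" where
  "superbracket X Y =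
     (\<Sum>p<2. \<Sum>q<2. (operator_part p X \<circ> operator_part q Y)
        - (-1) ^ (p * q) *\<^sub>R (operator_part q Y \<circ> operator_part p X))"

definition line_distribution :: "operator \<Rightarrow> operator set" where
  "line_distribution X = {(\<lambda>g. f * X g) | f. True}"


section \<open>The contact symmetry superalgebra of a third order odd ODE\<close>

definition total_derivative :: "superfun \<Rightarrow> operator" where
  "total_derivative G = (\<lambda>f. partial_x f + xi 1 * partial_xi 0 f + xi 2 * partial_xi 1 f
     + G * partial_xi 2 f)"

definition distribution_E :: "superfun \<Rightarrow> operator set" where
  "distribution_E G = line_distribution (total_derivative G)"

definition distribution_V :: "operator set" where
  "distribution_V = line_distribution (partial_xi 2)"

definition contact_symmetries :: "superfun \<Rightarrow> operator set" where
  "contact_symmetries G = {X \<in> supervector_fields.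
     superbracket X ` distribution_E G \<subseteq> distribution_E G \<and>
     superbracket X ` distribution_V \<subseteq> distribution_V}"

definition even_fields :: "operator set \<Rightarrow> operator set" where
  "even_fields S = {X \<in> S. superderivation 0 X}"

definition odd_fields :: "operator set \<Rightarrow> operator set" where
  "odd_fields S = {X \<in> S. superderivation 1 X}"

text \<open>Needed because \<open>dim\<close> is \<open>0\<close> on infinite-dimensional spaces.\<close>

definition fin_dim :: "'a::real_vector set \<Rightarrow> bool" where
  "fin_dim S \<longleftrightarrow> (\<exists>B. finite B \<and> S \<subseteq> span B)"

end

theory Submission
  imports Defs
begin

text \<open>
  Write \<open>a, b, c\<close> for the odd coordinates \<open>\<xi>, \<xi>', \<xi>''\<close>, and
  \<open>D = \<partial>\<^sub>x + b \<partial>\<^sub>a + c \<partial>\<^sub>b + G \<partial>\<^sub>c\<close> for the generator of the line \<open>E\<close>.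
  A homogeneous field \<open>X\<close> is a contact symmetry if and only if \<open>[X, D] = h D\<close> and
  \<open>[X, \<partial>\<^sub>c] = k \<partial>\<^sub>c\<close> for some superfunctions \<open>h\<close>, \<open>k\<close>
  (\<open>superbracket_preserves_line_iff\<close>).  By Hadamard's lemma a superderivation is
  determined by its values on the coordinates (\<open>superderivation_eqI\<close>).  Let \<open>P, U, V, W\<close>
  be the values of \<open>X\<close> on \<open>x, a, b, c\<close>.  Evaluated on the coordinates, the two conditions
  say that \<open>P, U, V\<close> do not depend on \<open>c\<close>, that \<open>h = - D P\<close>, and that
  \<open>V = D U - (D P) b\<close>, \<open>W = D V - (D P) c\<close>, \<open>X G = D W - (D P) G\<close>
  (\<open>symmetry_equations\<close>).  So \<open>P\<close> and \<open>U\<close> determine the symmetry.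

  Since \<open>V\<close> is free of \<open>c\<close>, the formula for \<open>V\<close> forces \<open>P = p(x)\<close>, \<open>U = u(x) a\<close>
  for an even symmetry and \<open>P = q(x) a\<close>, \<open>U = r(x)\<close> for an odd one.  In the even case let
  \<open>v\<close> and \<open>w\<close> be the coefficients of \<open>b\<close> in \<open>V\<close> and in \<open>W\<close>; in the odd case let \<open>s\<close>
  and \<open>w\<close> be the terms of \<open>V\<close> and \<open>W\<close> without odd coordinates.  The determining
  equations make \<open>(p, u, v, w)\<close>, respectively \<open>(q, r, s, w)\<close>, a solution of a linear
  homogeneous first order system whose coefficients come from \<open>G\<close>
  (\<open>even_symmetry_eq_zero\<close>, \<open>odd_symmetry_eq_zero\<close>).  Hence the value of these four functions
  at \<open>x = 0\<close> is an injective linear map from the symmetries of the given parity to \<open>\<real>\<^sup>4\<close>.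

  For \<open>G = 0\<close> both bounds are attained: the even symmetries include the prolongations of
  \<open>\<partial>\<^sub>x\<close>, \<open>x \<partial>\<^sub>x + \<xi> \<partial>\<^sub>\<xi>\<close>, \<open>x\<^sup>2 \<partial>\<^sub>x + 2 x \<xi> \<partial>\<^sub>\<xi>\<close>, \<open>\<xi> \<partial>\<^sub>\<xi>\<close>, the odd ones those of
  \<open>\<partial>\<^sub>\<xi>\<close>, \<open>x \<partial>\<^sub>\<xi>\<close>, \<open>x\<^sup>2 \<partial>\<^sub>\<xi>\<close>, \<open>\<xi> \<partial>\<^sub>x\<close>.
\<close>

text \<open>
  The index sets of components are literals such as \<open>{0, 1, 2}\<close>; this keeps \<open>1\<close> from being
  rewritten to \<open>Suc 0\<close>, so that such literals match the rules stated for them.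
\<close>

declare One_nat_def [simp del]

section \<open>Smooth functions and linear differential equations\<close>

text \<open>
  The quotient is \<open>g y = \<integral>\<^sub>0\<^sup>1 f' (a + t (y - a)) dt\<close>.  It is smooth because
  differentiating under the integral sign turns \<open>\<integral>\<^sub>0\<^sup>1 t\<^sup>n f\<^sup>(\<^sup>n\<^sup>+\<^sup>1\<^sup>) (a + t (y - a)) dt\<close> into the same
  expression for \<open>n + 1\<close>.
\<close>

lemma hadamard:
  assumes "smooth f"
  obtains g where "smooth g" "\<And>y. f y = f a + (y - a) * g y"
proof -
  define \<phi> where "\<phi> n y = integral {0..1} (\<lambda>t. t ^ n * (deriv ^^ Suc n) f (a + t * (y - a)))"
      for n y
  have D: "((deriv ^^ n) f has_real_derivative (deriv ^^ Suc n) f x) (at x)" for n x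
    using assms by (simp add: smooth_def DERIV_deriv_iff_field_differentiable)
  have C: "continuous_on UNIV ((deriv ^^ n) f)" for n
    using D by (meson DERIV_isCont continuous_at_imp_continuous_on)
  have C': "continuous_on S (\<lambda>z. (deriv ^^ n) f (k z))" if "continuous_on S k"
    for S n and k :: "'b::topological_space \<Rightarrow> real"
    using continuous_on_compose2[OF C that] by simp
  have \<phi>': "(\<phi> n has_real_derivative \<phi> (Suc n) y) (at y)" for n y
  proof -
    have "((\<lambda>y. integral (cbox 0 1) (\<lambda>t. t ^ n * (deriv ^^ Suc n) f (a + t * (y - a))))
        has_field_derivative integral (cbox 0 1)
            (\<lambda>t. t ^ Suc n * (deriv ^^ Suc (Suc n)) f (a + t * (y - a))))
        (at y within UNIV)"
    proof (rule leibniz_rule_field_derivative)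
      fix z t :: real
      show "((\<lambda>y. t ^ n * (deriv ^^ Suc n) f (a + t * (y - a))) has_field_derivative
          t ^ Suc n * (deriv ^^ Suc (Suc n)) f (a + t * (z - a))) (at z within UNIV)"
        by (rule DERIV_cong[OF DERIV_cmult[OF DERIV_chain2[OF D]]])
          (auto intro!: derivative_eq_intros)
    next
      fix z :: real
      show "(\<lambda>t. t ^ n * (deriv ^^ Suc n) f (a + t * (z - a))) integrable_on cbox 0 1"
        by (intro integrable_continuous continuous_intros C')
    next
      show "continuous_on (UNIV \<times> cbox 0 1)
          (\<lambda>(y, t). t ^ Suc n * (deriv ^^ Suc (Suc n)) f (a + t * (y - a)))"
        unfolding split_beta by (intro continuous_intros C')
    qed auto
    then show ?thesis unfolding \<phi>_def[abs_def] cbox_interval by simp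
  qed
  have "(deriv ^^ k) (\<phi> 0) = \<phi> k" for k
  proof (induction k)
    case (Suc k)
    then show ?case using \<phi>'[of k] by (auto simp: DERIV_imp_deriv)
  qed simp
  then have "smooth (\<phi> 0)"
    unfolding smooth_def using \<phi>' by (auto simp: field_differentiable_def)
  moreover have "f y = f a + (y - a) * \<phi> 0 y" for y
  proof -
    have "((\<lambda>t. (y - a) * deriv f (a + t * (y - a))) has_integral
        f (a + 1 * (y - a)) - f (a + 0 * (y - a))) {0..1}"
    proof (rule fundamental_theorem_of_calculus)
      fix t :: real
      show "((\<lambda>t. f (a + t * (y - a))) has_vector_derivative (y - a) * deriv f (a + t * (y - a)))
          (at t within {0..1})"
        unfolding has_real_derivative_iff_has_vector_derivative[symmetric]
        by (rule DERIV_subset[OF DERIV_cong[OF DERIV_chain2[OF D[of 0, simplified]]]])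
          (auto intro!: derivative_eq_intros)
    qed simp
    from integral_unique[OF this] show ?thesis by (simp add: \<phi>_def)
  qed
  ultimately show thesis by (rule that)
qed

text \<open>
  Gronwall's argument: \<open>E = \<Sum>\<^sub>i y\<^sub>i\<^sup>2\<close> satisfies \<open>\<bar>E'\<bar> \<le> 2 M E\<close> on every bounded
  interval around \<open>0\<close>, where \<open>M\<close> bounds the sum of the absolute values of the entries
  of \<open>A\<close>.  Hence \<open>E exp (- 2 M s)\<close> decreases to the right of \<open>0\<close>
  and \<open>E exp (2 M s)\<close> increases to the left of it, and \<open>E\<close>
  vanishes with its initial value.
\<close>

lemma linear_ode_zero:
  fixes y :: "'i \<Rightarrow> real \<Rightarrow> real" and A :: "'i \<Rightarrow> 'i \<Rightarrow> real \<Rightarrow> real"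
  assumes I: "finite I"
    and deriv: "\<And>i t. i \<in> I \<Longrightarrow> (y i has_real_derivative (\<Sum>j\<in>I. A i j t * y j t)) (at t)"
    and cont: "\<And>i j. i \<in> I \<Longrightarrow> j \<in> I \<Longrightarrow> continuous_on UNIV (A i j)"
    and zero: "\<And>i. i \<in> I \<Longrightarrow> y i 0 = 0"
    and i: "i \<in> I"
  shows "y i t = 0"
proof -
  define r where "r = \<bar>t\<bar>"
  have "compact ((\<lambda>s. \<Sum>i\<in>I. \<Sum>j\<in>I. \<bar>A i j s\<bar>) ` {-r..r})"
    by (intro compact_continuous_image continuous_intros continuous_on_subset[OF cont]) auto
  then have "bdd_above ((\<lambda>s. \<Sum>i\<in>I. \<Sum>j\<in>I. \<bar>A i j s\<bar>) ` {-r..r})"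
    by (simp add: bounded_imp_bdd_above compact_imp_bounded)
  then obtain M where M: "(\<Sum>i\<in>I. \<Sum>j\<in>I. \<bar>A i j s\<bar>) \<le> M" if "\<bar>s\<bar> \<le> r" for s
    unfolding bdd_above_def by (force simp: abs_le_iff)
  define E where "E s = (\<Sum>i\<in>I. (y i s)\<^sup>2)" for s
  define E' where "E' s = (\<Sum>i\<in>I. \<Sum>j\<in>I. 2 * A i j s * (y i s * y j s))" for s
  have E': "(E has_real_derivative E' s) (at s)" for s
    unfolding E_def E'_def
    by (rule DERIV_cong, rule DERIV_sum, rule DERIV_power, erule deriv)
      (simp add: sum_distrib_left mult_ac)
  have bound: "\<bar>E' s\<bar> \<le> 2 * M * E s" if "\<bar>s\<bar> \<le> r" for s
  proof -
    have yy: "\<bar>y i s * y j s\<bar> \<le> E s" if "i \<in> I" "j \<in> I" for i j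
    proof -
      have "(y i s)\<^sup>2 \<le> E s" "(y j s)\<^sup>2 \<le> E s"
        unfolding E_def using that I by (auto intro!: member_le_sum)
      moreover have "2 * \<bar>y i s * y j s\<bar> \<le> (y i s)\<^sup>2 + (y j s)\<^sup>2"
        using sum_squares_bound[of "\<bar>y i s\<bar>" "\<bar>y j s\<bar>"] by (simp add: abs_mult)
      ultimately show ?thesis by linarith
    qed
    have "\<bar>E' s\<bar> \<le> (\<Sum>i\<in>I. \<Sum>j\<in>I. 2 * \<bar>A i j s\<bar> * E s)"
      unfolding E'_def
      by (intro order_trans[OF sum_abs] sum_mono)
          (auto simp: abs_mult intro!: mult_left_mono yy[unfolded abs_mult])
    also have "\<dots> = 2 * (\<Sum>i\<in>I. \<Sum>j\<in>I. \<bar>A i j s\<bar>) * E s"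
      by (simp add: sum_distrib_left sum_distrib_right)
    also have "\<dots> \<le> 2 * M * E s"
      using M[OF that] by (intro mult_right_mono) (auto simp: E_def sum_nonneg)
    finally show ?thesis .
  qed
  have E0: "E 0 = 0" using zero by (simp add: E_def)
  have "E t \<le> 0"
  proof (cases "t \<ge> 0")
    case True
    have "E t * exp (- (2 * M) * t) \<le> E 0 * exp (- (2 * M) * 0)"
    proof (rule DERIV_nonpos_imp_nonincreasing[OF True])
      fix s assume s: "0 \<le> s" "s \<le> t"
      have "((\<lambda>s. E s * exp (- (2 * M) * s)) has_real_derivative
          (E' s - 2 * M * E s) * exp (- (2 * M) * s)) (at s)"
        by (auto intro!: derivative_eq_intros E' simp: algebra_simps)
      moreover have "E' s \<le> 2 * M * E s" using bound[of s] s by (simp add: r_def)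
      ultimately show "\<exists>y. ((\<lambda>s. E s * exp (- (2 * M) * s)) has_real_derivative y) (at s) \<and> y \<le> 0"
        by (auto intro!: exI mult_nonpos_nonneg)
    qed
    then show ?thesis by (simp add: E0 mult_le_0_iff)
  next
    case False
    then have "t \<le> 0" by simp
    then have "E t * exp (2 * M * t) \<le> E 0 * exp (2 * M * 0)"
    proof (rule DERIV_nonneg_imp_nondecreasing)
      fix s assume s: "t \<le> s" "s \<le> 0"
      have "((\<lambda>s. E s * exp (2 * M * s)) has_real_derivative
          (E' s + 2 * M * E s) * exp (2 * M * s)) (at s)"
        by (auto intro!: derivative_eq_intros E' simp: algebra_simps)
      moreover have "- E' s \<le> 2 * M * E s" using bound[of s] s by (simp add: r_def)
      ultimately show "\<exists>y. ((\<lambda>s. E s * exp (2 * M * s)) has_real_derivative y) (at s) \<and> 0 \<le> y"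
        by (auto intro!: exI mult_nonneg_nonneg)
    qed
    then show ?thesis by (simp add: E0 mult_le_0_iff)
  qed
  moreover have "(y i t)\<^sup>2 \<le> E t"
    unfolding E_def using i I by (auto intro!: member_le_sum)
  ultimately show ?thesis by (metis order_trans power2_less_eq_zero_iff)
qed

section \<open>Dimension estimates from linear maps\<close>

lemma fin_dim_dim_le_of_injective:
  fixes \<Phi> :: "'a::real_vector \<Rightarrow> 'b::euclidean_space"
  assumes T: "subspace T" and \<Phi>: "linear \<Phi>" and inj: "\<And>X. X \<in> T \<Longrightarrow> \<Phi> X = 0 \<Longrightarrow> X = 0"
    and S: "S \<subseteq> T"
  shows "fin_dim S" "dim S \<le> DIM('b)"
proof -
  obtain B where B: "B \<subseteq> T" "independent B" "T \<subseteq> span B"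
    using maximal_independent_subset[of T] by blast
  have "span B = T"
    using B T by (simp add: span_subspace)
  then have inj_B: "inj_on \<Phi> (span B)"
    using \<Phi> inj T by (simp add: linear_injective_on_subspace_0)
  have "independent (\<Phi> ` B)"
    using linear_independent_injective_image[OF \<Phi> B(2) inj_B] .
  then have "finite (\<Phi> ` B)" "card (\<Phi> ` B) \<le> DIM('b)"
    by (auto dest: independent_bound)
  moreover have "inj_on \<Phi> B"
    using inj_B by (rule inj_on_subset) (rule span_superset)
  ultimately have fin: "finite B" "card B \<le> DIM('b)"
    by (auto dest: finite_imageD simp: card_image)
  have "S \<subseteq> span B" using S B(3) by blast
  with fin(1) show "fin_dim S" unfolding fin_dim_def by blast
  show "dim S \<le> DIM('b)"
    using dim_le_card[OF \<open>S \<subseteq> span B\<close> fin(1)] fin(2) by simp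
qed

text \<open>
  The bound needs \<open>fin_dim S\<close>, since \<open>dim\<close> is \<open>0\<close> on infinite-dimensional spaces.
\<close>

lemma dim_ge_of_injective:
  fixes \<Psi> :: "'b::euclidean_space \<Rightarrow> 'a::real_vector"
  assumes \<Psi>: "linear \<Psi>" "inj \<Psi>" and S: "range \<Psi> \<subseteq> S" "fin_dim S"
  shows "DIM('b) \<le> dim S"
proof -
  obtain B where B: "finite B" "S \<subseteq> span B" using S(2) unfolding fin_dim_def by blast
  obtain C where C: "C \<subseteq> S" "independent C" "S \<subseteq> span C" "card C = dim S"
    using basis_exists[of S] by metis
  have "finite C"
    using independent_span_bound[OF B(1) C(2)] C(1) B(2) by blast
  moreover have "independent (\<Psi> ` Basis)"
    using linear_independent_injective_image[OF \<Psi>(1) independent_Basis] \<Psi>(2)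
    by (meson inj_on_subset subset_UNIV)
  moreover have "\<Psi> ` Basis \<subseteq> span C" using S(1) C(3) by blast
  ultimately have "card (\<Psi> ` Basis) \<le> card C"
    by (auto dest: independent_span_bound)
  then show ?thesis
    using \<Psi>(2) C(4) by (simp add: card_image inj_on_subset)
qed

section \<open>Superfunctions in components\<close>

text \<open>
  Unfolds the sum over \<open>Pow K\<close> that defines a product of superfunctions into explicit terms
  when \<open>K\<close> is a literal.
\<close>

lemma sum_Pow_insert:
  assumes "finite K" "a \<notin> K"
  shows "sum h (Pow (insert a K)) = sum h (Pow K) + (\<Sum>I\<in>Pow K. h (insert a I))"
proof -
  have "inj_on (insert a) (Pow K)"
    using assms(2) by (auto simp: inj_on_def)
  moreover have "Pow K \<inter> insert a ` Pow K = {}" using assms(2) by auto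
  ultimately show ?thesis
    unfolding Pow_insert using assms(1) by (simp add: sum.union_disjoint sum.reindex)
qed

lemma koszul_singleton: "koszul {i} {j} = (if j < i then -1 else 1)"
proof -
  have "{(i', j'). i' = i \<and> j' = j \<and> j' < i'} = (if j < i then {(i, j)} else {})" by auto
  then show ?thesis by (simp add: koszul_def)
qed

lemma koszul_insert_left:
  assumes "finite I" "finite J" "i \<notin> I" "I \<noteq> {}"
  shows "koszul (insert i I) J = koszul {i} J * koszul I J"
  using koszul_Un_left[of "{i}" I J] assms by simp

lemma koszul_insert_right:
  assumes "finite J" "j \<notin> J" "J \<noteq> {}"
  shows "koszul {i} (insert j J) = koszul {i} {j} * koszul {i} J"
  using koszul_Un_right[of "{i}" "{j}" J] assms by simp

lemma component_times_sum:
  "component (F * H) K = (\<lambda>t. \<Sum>I\<in>Pow K. koszul I (K - I) * component F I t * component H (K - I) t)"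
  by transfer simp

lemmas component_times_expand =
  component_times_sum sum_Pow_insert koszul_singleton koszul_insert_left koszul_insert_right

text \<open>
  The multiplication table.  Identities of superfunctions are checked through it, one monomial in
  the odd coordinates at a time.
\<close>

lemma component_times:
  "component (F * H) {} = (\<lambda>t. component F {} t * component H {} t)"
  "component (F * H) {0} = (\<lambda>t. component F {} t * component H {0} t
      + component F {0} t * component H {} t)"
  "component (F * H) {1} = (\<lambda>t. component F {} t * component H {1} t
      + component F {1} t * component H {} t)"
  "component (F * H) {2} = (\<lambda>t. component F {} t * component H {2} t
      + component F {2} t * component H {} t)"
  "component (F * H) {0,1} = (\<lambda>t. component F {} t * component H {0,1} t
      + component F {0} t * component H {1} t
     - component F {1} t * component H {0} t + component F {0,1} t * component H {} t)"
  "component (F * H) {0,2} = (\<lambda>t. component F {} t * component H {0,2} t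
      + component F {0} t * component H {2} t
     - component F {2} t * component H {0} t + component F {0,2} t * component H {} t)"
  "component (F * H) {1,2} = (\<lambda>t. component F {} t * component H {1,2} t
      + component F {1} t * component H {2} t
     - component F {2} t * component H {1} t + component F {1,2} t * component H {} t)"
  "component (F * H) {0,1,2}
      = (\<lambda>t. component F {} t * component H {0,1,2} t + component F {0} t * component H {1,2} t
     - component F {1} t * component H {0,2} t + component F {2} t * component H {0,1} t
     + component F {0,1} t * component H {2} t - component F {0,2} t * component H {1} t
     + component F {1,2} t * component H {0} t + component F {0,1,2} t * component H {} t)"
  by (simp_all add: component_times_expand insert_Diff_if fun_eq_iff)

lemma component_outside: "\<not> I \<subseteq> {0,1,2} \<Longrightarrow> component F I = (\<lambda>_. 0)"
  using component[of F] by simp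

lemma smooth_component: "smooth (component F I)"
  using component[of F] by simp

lemma deriv_component: "(component F I has_real_derivative deriv (component F I) t) (at t)"
  using smooth_component[of F I] unfolding smooth_def
  by (metis DERIV_deriv_iff_field_differentiable funpow_0)

lemma subsets_012:
  assumes "I \<subseteq> {0,1,2::nat}"
  shows "I = {} \<or> I = {0} \<or> I = {1} \<or> I = {2} \<or> I = {0,1} \<or> I = {0,2} \<or> I = {1,2} \<or> I = {0,1,2}"
proof -
  have "I \<in> Pow {0,1,2}" using assms by simp
  then show ?thesis by (simp add: Pow_insert) blast
qed

lemma superfun_eqI:
  assumes "component F {} = component H {}"
    "component F {0} = component H {0}" "component F {1} = component H {1}"
        "component F {2} = component H {2}"
    "component F {0,1} = component H {0,1}" "component F {0,2} = component H {0,2}"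
    "component F {1,2} = component H {1,2}" "component F {0,1,2} = component H {0,1,2}"
  shows "F = H"
proof -
  have "component F I = component H I" for I
  proof (cases "I \<subseteq> {0,1,2}")
    case True
    then show ?thesis using subsets_012[OF True] assms by (elim disjE) simp_all
  qed (simp add: component_outside)
  then show ?thesis by (simp add: component_inject[symmetric] fun_eq_iff)
qed

lemma component_linear [simp]:
  "component 0 I = (\<lambda>_. 0)"
  "component (F + H) I = (\<lambda>t. component F I t + component H I t)"
  "component (F - H) I = (\<lambda>t. component F I t - component H I t)"
  "component (- F) I = (\<lambda>t. - component F I t)"
  "component (c *\<^sub>R F) I = (\<lambda>t. c * component F I t)"
  by (transfer, simp)+

lemma component_one [simp]: "component 1 I = (if I = {} then (\<lambda>_. 1) else (\<lambda>_. 0))"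
  by transfer auto

lemma component_xi [simp]: "component (xi k) I = (if I = {k} \<and> k \<le> 2 then (\<lambda>_. 1) else (\<lambda>_. 0))"
  by transfer auto

lemma component_partial_x [simp]: "component (partial_x F) I = deriv (component F I)"
  by transfer simp

lemma component_partial_xi:
  "component (partial_xi k F) J =
    (\<lambda>t. if k \<in> J then 0 else (-1) ^ card {i \<in> J. i < k} * component F (insert k J) t)"
  by transfer simp

lemma component_partial_xi_0 [simp]: "k \<in> J \<Longrightarrow> component (partial_xi k F) J = (\<lambda>_. 0)"
  by (simp add: component_partial_xi)

lemma component_partial_xi_explicit [simp]:
  "component (partial_xi 0 F) {} = component F {0}"
  "component (partial_xi 0 F) {1} = component F {0,1}"
  "component (partial_xi 0 F) {2} = component F {0,2}"
  "component (partial_xi 0 F) {1,2} = component F {0,1,2}"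
  "component (partial_xi 1 F) {} = component F {1}"
  "component (partial_xi 1 F) {0} = (\<lambda>t. - component F {0,1} t)"
  "component (partial_xi 1 F) {2} = component F {1,2}"
  "component (partial_xi 1 F) {0,2} = (\<lambda>t. - component F {0,1,2} t)"
  "component (partial_xi 2 F) {} = component F {2}"
  "component (partial_xi 2 F) {0} = (\<lambda>t. - component F {0,2} t)"
  "component (partial_xi 2 F) {1} = (\<lambda>t. - component F {1,2} t)"
  "component (partial_xi 2 F) {0,1} = component F {0,1,2}"
proof -
  have c: "component (partial_xi k F) J
      = (\<lambda>t. (-1) ^ card (J \<inter> {..<k}) * component F (insert k J) t)"
    if "k \<notin> J" for k J
  proof -
    have "{i \<in> J. i < k} = J \<inter> {..<k}" by auto
    then show ?thesis using that by (simp add: component_partial_xi)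
  qed
  have e: "insert 2 {0,1} = {0,1,2::nat}" "insert 1 {0,2} = {0,1,2::nat}"
      "insert 1 {0} = {0,1::nat}"
    "insert 2 {0} = {0,2::nat}" "insert 2 {1} = {1,2::nat}"
    by auto
  show "component (partial_xi 0 F) {} = component F {0}"
  "component (partial_xi 0 F) {1} = component F {0,1}"
  "component (partial_xi 0 F) {2} = component F {0,2}"
  "component (partial_xi 0 F) {1,2} = component F {0,1,2}"
  "component (partial_xi 1 F) {} = component F {1}"
  "component (partial_xi 1 F) {0} = (\<lambda>t. - component F {0,1} t)"
  "component (partial_xi 1 F) {2} = component F {1,2}"
  "component (partial_xi 1 F) {0,2} = (\<lambda>t. - component F {0,1,2} t)"
  "component (partial_xi 2 F) {} = component F {2}"
  "component (partial_xi 2 F) {0} = (\<lambda>t. - component F {0,2} t)"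
  "component (partial_xi 2 F) {1} = (\<lambda>t. - component F {1,2} t)"
  "component (partial_xi 2 F) {0,1} = component F {0,1,2}"
    by (simp_all add: c e)
qed

text \<open>
The embedding of the smooth functions of \<open>x\<close>; other functions are sent to \<open>0\<close>.
\<close>

lift_definition body :: "(real \<Rightarrow> real) \<Rightarrow> superfun"
  is "\<lambda>f I. if I = {} \<and> smooth f then f else (\<lambda>_. 0)" by auto

lemma component_body [simp]: "smooth f \<Longrightarrow> component (body f) I = (if I = {} then f else (\<lambda>_. 0))"
  by transfer auto

lemma superfun_expand:
  "F = body (component F {}) + body (component F {0}) * xi 0 + body (component F {1}) * xi 1
     + body (component F {2}) * xi 2 + body (component F {0,1}) * (xi 0 * xi 1)
     + body (component F {0,2}) * (xi 0 * xi 2) + body (component F {1,2}) * (xi 1 * xi 2)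
     + body (component F {0,1,2}) * (xi 0 * (xi 1 * xi 2))"
  by (rule superfun_eqI) (simp_all add: component_times smooth_component)

section \<open>Parity\<close>

lemma homogeneous_iff:
  "homogeneous p F \<longleftrightarrow>
    (if even p then component F {0} = (\<lambda>_. 0) \<and> component F {1} = (\<lambda>_. 0) \<and> component F {2} =
        (\<lambda>_. 0)
       \<and> component F {0,1,2} = (\<lambda>_. 0)
     else component F {} = (\<lambda>_. 0) \<and> component F {0,1} = (\<lambda>_. 0) \<and> component F {0,2} = (\<lambda>_. 0)
       \<and> component F {1,2} = (\<lambda>_. 0))" (is "_ \<longleftrightarrow> ?R")
proof
  assume H: "homogeneous p F"
  have "component F I = (\<lambda>_. 0)" if "odd (card I + p)" for I
    using H that unfolding homogeneous_def by blast
  then show ?R by simp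
next
  assume R: ?R
  show "homogeneous p F"
    unfolding homogeneous_def
  proof (intro allI impI)
    fix I assume nz: "component F I \<noteq> (\<lambda>_. 0)"
    then have "I \<subseteq> {0,1,2}" using component_outside by blast
    then show "even (card I + p)"
      using nz R by (cases "even p") (auto dest!: subsets_012)
  qed
qed

lemma homogeneous_evenD:
  "homogeneous p F \<Longrightarrow> even p \<Longrightarrow>
    component F {0} = (\<lambda>_. 0) \<and> component F {1} = (\<lambda>_. 0)
    \<and> component F {2} = (\<lambda>_. 0) \<and> component F {0,1,2} = (\<lambda>_. 0)"
  by (simp add: homogeneous_iff)

lemma homogeneous_oddD:
  "homogeneous p F \<Longrightarrow> odd p \<Longrightarrow>
    component F {} = (\<lambda>_. 0) \<and> component F {0,1} = (\<lambda>_. 0)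
    \<and> component F {0,2} = (\<lambda>_. 0) \<and> component F {1,2} = (\<lambda>_. 0)"
  by (simp add: homogeneous_iff)

lemma homogeneous_cong: "even (p + q) \<Longrightarrow> homogeneous p F \<longleftrightarrow> homogeneous q F"
  by (simp add: homogeneous_iff)

lemma homogeneous_0 [simp]: "homogeneous p 0"
  and homogeneous_add: "homogeneous p F \<Longrightarrow> homogeneous p H \<Longrightarrow> homogeneous p (F + H)"
  and homogeneous_diff: "homogeneous p F \<Longrightarrow> homogeneous p H \<Longrightarrow> homogeneous p (F - H)"
  and homogeneous_scaleR: "homogeneous p F \<Longrightarrow> homogeneous p (c *\<^sub>R F)"
  by (auto simp: homogeneous_iff split: if_splits)

lemma homogeneous_mult:
  assumes "homogeneous p F" "homogeneous q H"
  shows "homogeneous (p + q) (F * H)"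
  using assms unfolding homogeneous_iff[of "p + q"]
  by (cases "even p"; cases "even q") (simp_all add: component_times homogeneous_iff)

text \<open>
  The sign is what makes left multiplication by a superfunction of parity \<open>r\<close> turn
  superderivations of parity \<open>p\<close> into superderivations of parity \<open>r + p\<close>.
\<close>

lemma supercommute:
  assumes "homogeneous p F" "homogeneous q H"
  shows "F * H = (-1) ^ (p * q) * (H * F)"
proof -
  have "F * H = (-1) ^ (p * q) *\<^sub>R (H * F)"
    using assms
    by (cases "even p"; cases "even q")
      (simp_all add: homogeneous_iff, (rule superfun_eqI; simp add: component_times algebra_simps)+)
  moreover have "(-1) ^ n * K = (-1) ^ n *\<^sub>R K" for n and K :: superfun
    by (simp add: minus_one_power_iff)
  ultimately show ?thesis by simp
qed

lemma homogeneous_body [simp]: "homogeneous 0 (body f)"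
  by (simp add: homogeneous_def body.rep_eq)

lemma homogeneous_one [simp]: "homogeneous 0 1"
  by (simp add: homogeneous_iff)

lemma homogeneous_xi [simp]: "homogeneous 1 (xi k)"
  by (auto simp: homogeneous_def)

lemma component_parity_part:
    "component (parity_part p F) I = (if even (card I + p) then component F I else (\<lambda>_. 0))"
  by transfer auto

lemma homogeneous_parity_part [simp]: "homogeneous p (parity_part p F)"
  by (simp add: homogeneous_def component_parity_part)

lemma parity_part_same: "homogeneous q F \<Longrightarrow> even (p + q) \<Longrightarrow> parity_part p F = F"
  by (intro superfun_eqI) (simp_all add: homogeneous_iff component_parity_part split: if_splits)

lemma parity_part_other: "homogeneous q F \<Longrightarrow> odd (p + q) \<Longrightarrow> parity_part p F = 0"
  by (intro superfun_eqI) (simp_all add: homogeneous_iff component_parity_part split: if_splits)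

lemma parity_part_cong: "even (p + q) \<Longrightarrow> parity_part p = parity_part q"
  by (intro ext superfun_eqI) (simp_all add: component_parity_part)

lemma parity_part_sum: "parity_part 0 F + parity_part 1 F = F"
  by (intro superfun_eqI) (simp_all add: component_parity_part)

section \<open>Superderivations and their values on the coordinates\<close>

lemma superderivation_linear: "superderivation p X \<Longrightarrow> linear X"
  by (simp add: superderivation_def)

lemma superderivation_homogeneous:
    "superderivation p X \<Longrightarrow> homogeneous q F \<Longrightarrow> homogeneous (p + q) (X F)"
  by (simp add: superderivation_def)

lemma superderivation_mult:
  "superderivation p X \<Longrightarrow> homogeneous q F \<Longrightarrow> X (F * H) = X F * H + (-1) ^ (p * q) * F * X H"
  by (simp add: superderivation_def)

lemma superderivation_one:
  assumes "superderivation p X"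
  shows "X 1 = 0"
  using superderivation_mult[OF assms homogeneous_one, of 1] by simp

lemma superderivation_cong:
  assumes "even (p + q)" "superderivation p X"
  shows "superderivation q X"
proof -
  have "homogeneous (p + r) = homogeneous (q + r)" for r
    using assms(1) by (intro ext homogeneous_cong) auto
  moreover have "(-1::superfun) ^ (p * r) = (-1) ^ (q * r)" for r
    using assms(1) by (simp add: minus_one_power_iff)
  ultimately show ?thesis
    using assms(2) by (simp add: superderivation_def)
qed

lemma superderivation_zero: "superderivation p (\<lambda>_. 0)"
  by (simp add: superderivation_def linear_zero)

lemma superderivation_add:
  assumes "superderivation p X" "superderivation p Y"
  shows "superderivation p (\<lambda>F. X F + Y F)"
  using assms unfolding superderivation_def
  by (auto intro: linear_compose_add homogeneous_add simp: algebra_simps)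

lemma superderivation_scaleR:
  assumes "superderivation p X"
  shows "superderivation p (\<lambda>F. c *\<^sub>R X F)"
  using assms unfolding superderivation_def
  by (auto intro: linear_compose_scale_right homogeneous_scaleR simp: algebra_simps)

lemma superderivation_diff:
  assumes "superderivation p X" "superderivation p Y"
  shows "superderivation p (\<lambda>F. X F - Y F)"
  using superderivation_add[OF assms(1) superderivation_scaleR[OF assms(2), of "-1"]] by simp

lemma superderivation_left_mult:
  assumes F: "homogeneous r F" and X: "superderivation p X"
  shows "superderivation (r + p) (\<lambda>H. F * X H)"
  unfolding superderivation_def
proof (intro conjI allI impI)
  show "linear (\<lambda>H. F * X H)"
    using superderivation_linear[OF X]
    by (intro linearI) (simp_all add: linear_add linear_scale distrib_left)
next
  fix q H assume H: "homogeneous q H"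
  show "homogeneous (r + p + q) (F * X H)"
    using homogeneous_mult[OF F superderivation_homogeneous[OF X H]] by (simp add: add.assoc)
  fix K
  have "F * X (H * K) = F * X H * K + (-1) ^ (p * q) * (F * H) * X K"
    unfolding superderivation_mult[OF X H]
    by (cases "even (p * q)") (simp_all add: algebra_simps)
  also have "F * H = (-1) ^ (r * q) * (H * F)"
    by (rule supercommute[OF F H])
  finally show "F * X (H * K) = F * X H * K + (-1) ^ ((r + p) * q) * H * (F * X K)"
    by (simp add: algebra_simps power_add)
qed

text \<open>
  In the expansion of the bracket at \<open>F * K\<close> each of the mixed terms \<open>X F * Y K\<close> and
  \<open>Y F * X K\<close> occurs twice, with opposite signs, whatever the parities.
\<close>

lemma superderivation_superbracket:
  assumes X: "superderivation p X" and Y: "superderivation q Y"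
  shows "superderivation (p + q) (\<lambda>F. X (Y F) - (-1) ^ (p * q) * Y (X F))"
  unfolding superderivation_def
proof (intro conjI allI impI)
  have lX: "linear X" and lY: "linear Y" using X Y by (auto simp: superderivation_def)
  have sc: "(-1) ^ n * K = (-1) ^ n *\<^sub>R K" for n and K :: superfun
    by (simp add: minus_one_power_iff)
  show "linear (\<lambda>F. X (Y F) - (-1) ^ (p * q) * Y (X F))"
    unfolding sc
    using linear_compose[OF lX lY] linear_compose[OF lY lX]
    by (intro linear_compose_sub linear_compose_scale_right) (simp_all add: o_def)
  fix r F assume F: "homogeneous r F"
  have XF: "homogeneous (p + r) (X F)" and YF: "homogeneous (q + r) (Y F)"
    using X Y F by (auto intro: superderivation_homogeneous)
  show "homogeneous (p + q + r) (X (Y F) - (-1) ^ (p * q) * Y (X F))"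
    unfolding sc
    using superderivation_homogeneous[OF X YF] superderivation_homogeneous[OF Y XF]
    by (intro homogeneous_diff homogeneous_scaleR) (simp_all add: ac_simps)
  fix K
  show "X (Y (F * K)) - (-1) ^ (p * q) * Y (X (F * K)) =
     (X (Y F) - (-1) ^ (p * q) * Y (X F)) * K +
     (-1) ^ ((p + q) * r) * F * (X (Y K) - (-1) ^ (p * q) * Y (X K))"
    unfolding superderivation_mult[OF X F] superderivation_mult[OF Y F]
    by (cases "even p"; cases "even q"; cases "even r")
      (simp_all add: linear_add[OF lX] linear_add[OF lY] linear_neg[OF lX] linear_neg[OF lY]
        linear_diff[OF lX] linear_diff[OF lY]
        superderivation_mult[OF X F] superderivation_mult[OF Y F]
        superderivation_mult[OF X YF] superderivation_mult[OF Y XF] algebra_simps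
            minus_one_power_iff)
qed

lemma superderivation_partial_x: "superderivation 0 partial_x"
  unfolding superderivation_def
proof (intro conjI allI impI)
  have d: "deriv (\<lambda>t. component F I t + component H I t) t
      = deriv (component F I) t + deriv (component H I) t"
    "deriv (\<lambda>t. c * component F I t) t = c * deriv (component F I) t" for F H I t c
    by (auto intro!: DERIV_imp_deriv derivative_eq_intros deriv_component)
  show "linear partial_x"
    by (rule linearI) (simp_all add: component_inject[symmetric] fun_eq_iff d)
  show "homogeneous (0 + q) (partial_x F)" if "homogeneous q F" for q F
    using that by (auto simp: homogeneous_iff split: if_splits)
  show "partial_x (F * H) = partial_x F * H + (-1) ^ (0 * q) * F * partial_x H" for q F H
    by (rule superfun_eqI; simp add: component_times; rule ext, rule DERIV_imp_deriv)
      (rule derivative_eq_intros deriv_component refl | simp add: algebra_simps)+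
qed

lemma superderivation_partial_xi:
  assumes k: "k \<le> 2"
  shows "superderivation 1 (partial_xi k)"
  unfolding superderivation_def
proof (intro conjI allI impI)
  have k: "k = 0 \<or> k = 1 \<or> k = 2" using k by linarith
  show "linear (partial_xi k)"
    by (rule linearI) (simp_all add: component_inject[symmetric] fun_eq_iff component_partial_xi
        algebra_simps)
  fix q F assume F: "homogeneous q F"
  show "homogeneous (1 + q) (partial_xi k F)"
    using F k unfolding homogeneous_iff[of "1 + q"]
    by (elim disjE; cases "even q") (simp_all add: homogeneous_iff)
  fix H
  have sc: "(-1) ^ n * F * K = (-1) ^ n *\<^sub>R (F * K)" for n and K :: superfun
    by (simp add: minus_one_power_iff)
  have "partial_xi k (F * H) = partial_xi k F * H + (-1) ^ (1 * q) *\<^sub>R (F * partial_xi k H)"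
  proof (cases "even q")
    case True
    from k show ?thesis
      using homogeneous_evenD[OF F True] True
      by (elim disjE; intro superfun_eqI; simp add: component_times algebra_simps)
  next
    case False
    from k show ?thesis
      using homogeneous_oddD[OF F False] False
      by (elim disjE; intro superfun_eqI; simp add: component_times algebra_simps)
  qed
  then show "partial_xi k (F * H) = partial_xi k F * H + (-1) ^ (1 * q) * F * partial_xi k H"
    by (simp only: sc)
qed

text \<open>
The even coordinate \<open>x\<close>.
\<close>

definition coord :: "superfun" where "coord = body (\<lambda>t. t)"

text \<open>
  On a function \<open>f\<close> of \<open>x\<close>, write \<open>f = f(a) + (x - a) g\<close>.  Since \<open>Y\<close> annihilates constants
  and \<open>x - a\<close>, it follows that \<open>Y f = (x - a) Y g\<close>, all of whose components vanish at \<open>a\<close>.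
  As \<open>a\<close> is arbitrary, \<open>Y f = 0\<close>; the remaining superfunctions are sums of products of such
  \<open>f\<close> and odd coordinates.
\<close>

lemma superderivation_eq_zero:
  assumes Y: "superderivation p Y" and x: "Y coord = 0" and xi: "\<And>k. k \<le> 2 \<Longrightarrow> Y (xi k) = 0"
  shows "Y F = 0"
proof -
  have lin: "linear Y" using Y by (rule superderivation_linear)
  have mult: "Y (G * H) = 0" if "homogeneous q G" "Y G = 0" "Y H = 0" for q G H
    using superderivation_mult[OF Y that(1), of H] that by simp
  have body: "Y (body f) = 0" if f: "smooth f" for f
  proof -
    have "component (Y (body f)) I a = 0" for I a
    proof -
      obtain g where g: "smooth g" "\<And>t. f t = f a + (t - a) * g t"
        using hadamard[OF f, of a] by blast
      have l: "smooth (\<lambda>t. t - a)" by (intro smooth_diff) simp_all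
      \<comment> \<open>Hadamard's lemma at the point \<open>a\<close>, read in superfunctions.\<close>
      have 1: "body f = f a *\<^sub>R 1 + body (\<lambda>t. t - a) * body g"
        using f g(1) l by (intro superfun_eqI) (simp_all add: component_times g(2)[symmetric])
      have "body (\<lambda>t. t - a) = coord - a *\<^sub>R 1"
        using l by (intro superfun_eqI) (simp_all add: fun_eq_iff coord_def)
      then have "Y (body (\<lambda>t. t - a)) = 0"
        by (simp add: linear_diff[OF lin] linear_scale[OF lin] superderivation_one[OF Y] x)
      then have "Y (body f) = body (\<lambda>t. t - a) * Y (body g)"
        unfolding 1
        by (simp add: linear_add[OF lin] linear_scale[OF lin] superderivation_one[OF Y]
            superderivation_mult[OF Y homogeneous_body])
      then have "component (Y (body f)) I a =
          (\<Sum>J\<in>Pow I. koszul J (I - J) * component (body (\<lambda>t. t - a)) J a * component (Y (body g))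
              (I - J) a)"
        by (simp add: component_times_sum)
      also have "\<dots> = 0"
        using l by (intro sum.neutral) auto
      finally show ?thesis .
    qed
    then show ?thesis by (simp add: component_inject[symmetric] fun_eq_iff)
  qed
  have coeff: "Y (body (component F I) * G) = 0" if "Y G = 0" for I G
    by (rule mult[OF homogeneous_body body[OF smooth_component] that])
  have xi': "Y (xi 0) = 0" "Y (xi 1) = 0" "Y (xi 2) = 0"
    by (simp_all add: xi)
  have xi_mult: "Y (xi k * G) = 0" if "Y (xi k) = 0" "Y G = 0" for k G
    by (rule mult[OF homogeneous_xi that])
  show ?thesis
    using arg_cong[OF superfun_expand[of F], of Y]
    by (simp only: linear_add[OF lin] body[OF smooth_component] coeff xi_mult xi' add_0)
qed

lemma superderivation_eqI:
  assumes "superderivation p X" "superderivation p Y" "X coord = Y coord"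
    "\<And>k. k \<le> 2 \<Longrightarrow> X (xi k) = Y (xi k)"
  shows "X = Y"
  using superderivation_eq_zero[OF superderivation_diff[OF assms(1,2)]] assms(3,4)
  by (simp add: fun_eq_iff)

lemma deriv_const_ident [simp]: "deriv (\<lambda>_. c::real) = (\<lambda>_. 0)" "deriv (\<lambda>t::real. t) = (\<lambda>_. 1)"
  by (auto simp: fun_eq_iff)

lemma partial_coord [simp]: "partial_x coord = 1" "partial_x (xi k) = 0" "partial_xi k coord = 0"
  "partial_xi k (xi j) = (if k = j \<and> k \<le> 2 then 1 else 0)"
  by (auto simp: component_inject[symmetric] fun_eq_iff coord_def component_partial_xi)

definition vector_field :: "superfun \<Rightarrow> superfun \<Rightarrow> superfun \<Rightarrow> superfun \<Rightarrow> operator" where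
  "vector_field P U V W = (\<lambda>F. P * partial_x F + U * partial_xi 0 F + V * partial_xi 1 F
      + W * partial_xi 2 F)"

lemma superderivation_vector_field:
  assumes "homogeneous p P" "homogeneous (p + 1) U" "homogeneous (p + 1) V" "homogeneous (p + 1) W"
  shows "superderivation p (vector_field P U V W)"
proof -
  have "superderivation p (\<lambda>F. P * partial_x F)"
    using superderivation_left_mult[OF assms(1) superderivation_partial_x] by simp
  moreover have "superderivation p (\<lambda>F. Q * partial_xi k F)" if "homogeneous (p + 1) Q" "k \<le> 2"
      for Q k
    using superderivation_left_mult[OF that(1) superderivation_partial_xi[OF that(2)]]
    by (rule superderivation_cong[rotated]) simp
  ultimately show ?thesis
    unfolding vector_field_def using assms by (intro superderivation_add) simp_all
qed

lemma vector_field_coord [simp]: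
  "vector_field P U V W coord = P" "vector_field P U V W (xi 0) = U"
  "vector_field P U V W (xi 1) = V" "vector_field P U V W (xi 2) = W"
  by (simp_all add: vector_field_def)

text \<open>
  This turns \<open>X G\<close> in the determining equations into an explicit expression in the values of
  \<open>X\<close> on the coordinates.
\<close>

lemma superderivation_eq_vector_field:
  assumes "superderivation p X"
  shows "X = vector_field (X coord) (X (xi 0)) (X (xi 1)) (X (xi 2))"
proof (rule superderivation_eqI[OF assms])
  have "homogeneous p (X coord)"
    using superderivation_homogeneous[OF assms homogeneous_body] by (simp add: coord_def)
  moreover have "homogeneous (p + 1) (X (xi k))" for k
    using superderivation_homogeneous[OF assms homogeneous_xi] .
  ultimately show "superderivation p (vector_field (X coord) (X (xi 0)) (X (xi 1)) (X (xi 2)))"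
    by (intro superderivation_vector_field)
  fix k :: nat assume "k \<le> 2"
  then have "k = 0 \<or> k = 1 \<or> k = 2" by linarith
  then show "X (xi k) = vector_field (X coord) (X (xi 0)) (X (xi 1)) (X (xi 2)) (xi k)" by auto
qed simp

section \<open>The symmetry conditions on homogeneous fields\<close>

lemma parity_part_mult:
  assumes "homogeneous s H"
  shows "parity_part r (F * H) = parity_part (r + s) F * H"
proof (cases "even s")
  case True
  then show ?thesis using homogeneous_evenD[OF assms]
    by (cases "even r"; intro superfun_eqI; simp add: component_times component_parity_part)
next
  case False
  then show ?thesis using homogeneous_oddD[OF assms]
    by (cases "even r"; intro superfun_eqI; simp add: component_times component_parity_part)
qed

lemma sum_less_2: "(\<Sum>q<2. f q) = f 0 + f (1::nat)"
  by (simp add: numeral_2_eq_2 One_nat_def)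

lemma operator_part_eq:
  "operator_part q A = (\<lambda>F. parity_part q (A (parity_part 0 F))
      + parity_part (q + 1) (A (parity_part 1 F)))"
  by (simp add: operator_part_def sum_less_2)

lemma operator_part_superderivation:
  assumes "superderivation p X"
  shows "operator_part q X = (if even (p + q) then X else (\<lambda>_. 0))"
proof
  fix F
  have h: "homogeneous (p + r) (X (parity_part r F))" for r
    by (rule superderivation_homogeneous[OF assms homogeneous_parity_part])
  have "X F = X (parity_part 0 F) + X (parity_part 1 F)"
    by (metis linear_add parity_part_sum superderivation_linear[OF assms])
  then show "operator_part q X F = (if even (p + q) then X else (\<lambda>_. 0)) F"
    using h[of 0] h[of 1]
    by (simp add: operator_part_eq parity_part_same parity_part_other)
qed

lemma operator_part_left_mult:
  assumes "superderivation d D"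
  shows "operator_part q (\<lambda>F. H * D F) = (\<lambda>F. parity_part (q + d) H * D F)"
proof
  fix F
  have h: "homogeneous (d + r) (D (parity_part r F))" for r
    by (rule superderivation_homogeneous[OF assms homogeneous_parity_part])
  have "parity_part (q + 1 + (d + 1)) = parity_part (q + d)"
    by (rule parity_part_cong) simp
  moreover have "D F = D (parity_part 0 F) + D (parity_part 1 F)"
    by (metis linear_add parity_part_sum superderivation_linear[OF assms])
  ultimately show "operator_part q (\<lambda>F. H * D F) F = parity_part (q + d) H * D F"
    using h[of 0] h[of 1] by (simp add: operator_part_eq parity_part_mult algebra_simps)
qed

text \<open>
  The field \<open>H D\<close> has the parity parts \<open>H\<^sub>q\<^sub>+\<^sub>d D\<close>, where \<open>H\<^sub>j\<close> is the part of \<open>H\<close> of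
  parity \<open>j\<close>, and \<open>[X, H\<^sub>j D] = X(H\<^sub>j) D + (-1)\<^sup>p\<^sup>j H\<^sub>j [X, D]\<close>.
\<close>

lemma superbracket_left_mult:
  assumes X: "superderivation p X" "p < 2" and D: "superderivation d D"
  shows "superbracket X (\<lambda>F. H * D F) = (\<lambda>F. \<Sum>q<2. X (parity_part (q + d) H) * D F
    + (-1) ^ (p * (q + d)) * parity_part (q + d) H * (X (D F) - (-1) ^ (p * d) * D (X F)))"
proof
  fix F
  have sc: "(-1) ^ n *\<^sub>R K = (-1) ^ n * K" for n and K :: superfun
    by (simp add: minus_one_power_iff)
  have "superbracket X (\<lambda>F. H * D F) F = (\<Sum>q<2. X (parity_part (q + d) H * D F)
      - (-1) ^ (p * q) * (parity_part (q + d) H * D (X F)))"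
  proof -
    have "p = 0 \<or> p = 1" using X(2) by auto
    moreover have "X 0 = 0" "D 0 = 0"
      using superderivation_linear[OF X(1)] superderivation_linear[OF D] by (simp_all add: linear_0)
    ultimately show ?thesis
      by (auto simp: superbracket_def operator_part_superderivation[OF X(1)]
          operator_part_left_mult[OF D]
          sum_less_2 scaleR_fun_def)
  qed
  also have "\<dots> = (\<Sum>q<2. X (parity_part (q + d) H) * D F
    + (-1) ^ (p * (q + d)) * parity_part (q + d) H * (X (D F) - (-1) ^ (p * d) * D (X F)))"
    by (intro sum.cong refl)
      (simp add: superderivation_mult[OF X(1) homogeneous_parity_part] algebra_simps
          minus_one_power_iff)
  finally show "superbracket X (\<lambda>F. H * D F) F = \<dots>" .
qed

text \<open>
  It suffices to test the generator of the line: the bracket with any other multiple of \<open>D\<close>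
  differs from a multiple of \<open>[X, D]\<close> by a multiple of \<open>D\<close>.
\<close>

lemma superbracket_preserves_line_iff:
  assumes X: "superderivation p X" "p < 2" and D: "superderivation d D"
  shows "superbracket X ` line_distribution D \<subseteq> line_distribution D \<longleftrightarrow>
    (\<exists>h. \<forall>F. X (D F) - (-1) ^ (p * d) * D (X F) = h * D F)" (is "?L \<longleftrightarrow> ?R")
proof
  assume ?L
  moreover have "(\<lambda>F. 1 * D F) \<in> line_distribution D"
    unfolding line_distribution_def by blast
  ultimately obtain h where h: "superbracket X (\<lambda>F. 1 * D F) = (\<lambda>F. h * D F)"
    unfolding line_distribution_def by blast
  have X0: "X 0 = 0" using superderivation_linear[OF X(1)] by (rule linear_0)
  have "X (D F) - (-1) ^ (p * d) * D (X F) = h * D F" for F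
    using fun_cong[OF h, of F]
    unfolding superbracket_left_mult[OF X D] sum_less_2
    by (cases "even d")
      (simp_all add: parity_part_same[OF homogeneous_one] parity_part_other[OF homogeneous_one]
        X0 superderivation_one[OF X(1)] minus_one_power_iff)
  then show ?R by blast
next
  assume ?R
  then obtain h where h: "X (D F) - (-1) ^ (p * d) * D (X F) = h * D F" for F by blast
  have "superbracket X (\<lambda>F. H * D F) = (\<lambda>F. (\<Sum>q<2. X (parity_part (q + d) H)
      + (-1) ^ (p * (q + d)) * parity_part (q + d) H * h) * D F)" for H
    unfolding superbracket_left_mult[OF X D] h
    by (simp add: sum_distrib_right algebra_simps)
  then show ?L
    unfolding line_distribution_def by blast
qed

lemma superderivation_total_derivative:
  assumes "odd_superfun G"
  shows "superderivation 0 (total_derivative G)"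
proof -
  have "total_derivative G = vector_field 1 (xi 1) (xi 2) G"
    by (simp add: total_derivative_def vector_field_def)
  then show ?thesis using assms by (auto intro!: superderivation_vector_field)
qed

text \<open>
  The homogeneous contact symmetries of parity \<open>p\<close>, with the conditions in terms of the
  generators \<open>D\<close> and \<open>\<partial>\<^sub>c\<close>.
\<close>

definition symmetry_space :: "nat \<Rightarrow> superfun \<Rightarrow> operator set" where
  "symmetry_space p G = {X. superderivation p X \<and>
     (\<exists>h. \<forall>F. X (total_derivative G F) - total_derivative G (X F) = h * total_derivative G F) \<and>
     (\<exists>h. \<forall>F. X (partial_xi 2 F) - (-1) ^ p * partial_xi 2 (X F) = h * partial_xi 2 F)}"

lemma symmetry_space_0: "odd_superfun G \<Longrightarrow> even_fields (contact_symmetries G) = symmetry_space 0 G"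
  and symmetry_space_1: "odd_superfun G \<Longrightarrow> odd_fields (contact_symmetries G) = symmetry_space 1 G"
proof -
  assume G: "odd_superfun G"
  have eq: "X \<in> contact_symmetries G \<longleftrightarrow> X \<in> symmetry_space p G" if X: "superderivation p X" "p < 2"
      for p X
  proof -
    have "X = X + (\<lambda>_. 0)" "X = (\<lambda>_. 0) + X" by (simp_all add: fun_eq_iff)
    then have "X \<in> supervector_fields"
      using that superderivation_zero less_2_cases[OF X(2)]
          unfolding supervector_fields_def One_nat_def by blast
    then show ?thesis
      using X(1) superbracket_preserves_line_iff[OF X superderivation_total_derivative[OF G]]
        superbracket_preserves_line_iff[OF X superderivation_partial_xi[of 2]]
      by (simp add: contact_symmetries_def symmetry_space_def distribution_E_def distribution_V_def)
  qed
  have sd: "superderivation p X" if "X \<in> symmetry_space p G" for p X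
    using that by (simp add: symmetry_space_def)
  have imp: "X \<in> contact_symmetries G" if "X \<in> symmetry_space p G" "p < 2" for p X
    using eq[OF sd[OF that(1)] that(2)] that(1) by simp
  show "even_fields (contact_symmetries G) = symmetry_space 0 G"
    "odd_fields (contact_symmetries G) = symmetry_space 1 G"
    unfolding even_fields_def odd_fields_def
        by (auto simp: eq intro: sd imp[where p=0] imp[where p=1])
qed

lemma subspace_symmetry_space:
  assumes G: "odd_superfun G"
  shows "subspace (symmetry_space p G)"
proof (rule subspaceI)
  note lin = superderivation_linear[OF superderivation_total_derivative[OF G]]
    superderivation_linear[OF superderivation_partial_xi[of 2, simplified]]
  have sc: "(-1) ^ p * K = (-1) ^ p *\<^sub>R K" for K :: superfun
    by (simp add: minus_one_power_iff)
  show "0 \<in> symmetry_space p G"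
    by (auto simp: symmetry_space_def zero_fun_def superderivation_zero linear_0[OF lin(1)]
        linear_0[OF lin(2)] intro!: exI[of _ 0])
  show "X + Y \<in> symmetry_space p G" if "X \<in> symmetry_space p G" "Y \<in> symmetry_space p G" for X Y
  proof -
    from that obtain h k h' k' where X: "superderivation p X"
      "\<And>F. X (total_derivative G F) - total_derivative G (X F) = h * total_derivative G F"
      "\<And>F. X (partial_xi 2 F) - (-1) ^ p * partial_xi 2 (X F) = k * partial_xi 2 F"
      and Y: "superderivation p Y"
      "\<And>F. Y (total_derivative G F) - total_derivative G (Y F) = h' * total_derivative G F"
      "\<And>F. Y (partial_xi 2 F) - (-1) ^ p * partial_xi 2 (Y F) = k' * partial_xi 2 F"
      unfolding symmetry_space_def by blast
    have "superderivation p (X + Y)"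
      using superderivation_add[OF X(1) Y(1)] by (simp add: plus_fun_def)
    moreover have "(X + Y) (total_derivative G F) - total_derivative G ((X + Y) F)
        = (h + h') * total_derivative G F" for F
      by (simp add: linear_add[OF lin(1)] distrib_right X(2)[symmetric] Y(2)[symmetric])
    moreover have "(X + Y) (partial_xi 2 F) - (-1) ^ p * partial_xi 2 ((X + Y) F)
        = (k + k') * partial_xi 2 F" for F
      by (simp add: linear_add[OF lin(2)] distrib_right distrib_left X(3)[symmetric]
          Y(3)[symmetric])
    ultimately show ?thesis unfolding symmetry_space_def by blast
  qed
  show "c *\<^sub>R X \<in> symmetry_space p G" if "X \<in> symmetry_space p G" for c X
  proof -
    from that obtain h k where X: "superderivation p X"
      "\<And>F. X (total_derivative G F) - total_derivative G (X F) = h * total_derivative G F"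
      "\<And>F. X (partial_xi 2 F) - (-1) ^ p * partial_xi 2 (X F) = k * partial_xi 2 F"
      unfolding symmetry_space_def by blast
    have "superderivation p (c *\<^sub>R X)"
      using superderivation_scaleR[OF X(1)] by (simp add: scaleR_fun_def)
    moreover have "(c *\<^sub>R X) (total_derivative G F) - total_derivative G ((c *\<^sub>R X) F)
        = (c *\<^sub>R h) * total_derivative G F" for F
      by (simp add: scaleR_fun_def linear_scale[OF lin(1)] X(2)[symmetric] scaleR_diff_right)
    moreover have "(c *\<^sub>R X) (partial_xi 2 F) - (-1) ^ p * partial_xi 2 ((c *\<^sub>R X) F)
        = (c *\<^sub>R k) * partial_xi 2 F" for F
      by (simp add: scaleR_fun_def linear_scale[OF lin(2)] X(3)[symmetric] scaleR_diff_right)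
    ultimately show ?thesis unfolding symmetry_space_def by blast
  qed
qed

lemma total_derivative_coord [simp]:
  "total_derivative G coord = 1" "total_derivative G (xi 0) = xi 1"
  "total_derivative G (xi 1) = xi 2" "total_derivative G (xi 2) = G"
  by (simp_all add: total_derivative_def)

text \<open>
  The conditions \<open>[X, D] = h D\<close> and \<open>[X, \<partial>\<^sub>c] = k \<partial>\<^sub>c\<close> evaluated on the coordinates.  On \<open>x\<close>
  the first one determines \<open>h\<close>, because \<open>D x = 1\<close>; on \<open>x\<close>, \<open>a\<close>, \<open>b\<close> the second one says
  that \<open>P\<close>, \<open>U\<close>, \<open>V\<close> do not depend on \<open>c\<close>.
\<close>

lemma symmetry_equations:
  assumes "X \<in> symmetry_space p G"
  shows "X (xi 1) = total_derivative G (X (xi 0)) - total_derivative G (X coord) * xi 1"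
    "X (xi 2) = total_derivative G (X (xi 1)) - total_derivative G (X coord) * xi 2"
    "X G = total_derivative G (X (xi 2)) - total_derivative G (X coord) * G"
    "partial_xi 2 (X coord) = 0" "partial_xi 2 (X (xi 0)) = 0" "partial_xi 2 (X (xi 1)) = 0"
proof -
  from assms obtain h k where X: "superderivation p X"
      "\<And>F. X (total_derivative G F) - total_derivative G (X F) = h * total_derivative G F"
      "\<And>F. X (partial_xi 2 F) - (-1) ^ p * partial_xi 2 (X F) = k * partial_xi 2 F"
      unfolding symmetry_space_def by blast
  note one = superderivation_one[OF X(1)]
  have X0: "X 0 = 0" using superderivation_linear[OF X(1)] by (rule linear_0)
  have h: "h = - total_derivative G (X coord)"
    using X(2)[of coord] by (simp add: one)
  show "X (xi 1) = total_derivative G (X (xi 0)) - total_derivative G (X coord) * xi 1"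
    "X (xi 2) = total_derivative G (X (xi 1)) - total_derivative G (X coord) * xi 2"
    "X G = total_derivative G (X (xi 2)) - total_derivative G (X coord) * G"
    using X(2)[of "xi 0"] X(2)[of "xi 1"] X(2)[of "xi 2"] by (simp_all add: h algebra_simps)
  show "partial_xi 2 (X coord) = 0" "partial_xi 2 (X (xi 0)) = 0" "partial_xi 2 (X (xi 1)) = 0"
    using X(3)[of coord] X(3)[of "xi 0"] X(3)[of "xi 1"]
    by (cases "even p"; simp add: X0)+
qed

lemma symmetry_eq_zero:
  assumes X: "X \<in> symmetry_space p G" and G: "odd_superfun G" and "X coord = 0" "X (xi 0) = 0"
  shows "X = 0"
proof -
  have sd: "superderivation p X" using X by (simp add: symmetry_space_def)
  have "total_derivative G 0 = 0"
    by (rule linear_0[OF superderivation_linear[OF superderivation_total_derivative[OF G]]])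
  then have "X (xi 1) = 0" "X (xi 2) = 0"
    using symmetry_equations(1,2)[OF X] assms(3,4) by simp_all
  with assms(3,4) show ?thesis
    by (subst superderivation_eq_vector_field[OF sd]) (simp add: vector_field_def zero_fun_def)
qed

section \<open>The determining equations as linear systems\<close>

text \<open>
The form of uniqueness used for the determining equations, which have four unknowns.
\<close>

lemma linear_ode4_zero:
  fixes A :: "nat \<Rightarrow> nat \<Rightarrow> real \<Rightarrow> real"
  assumes "\<And>t. (y0 has_real_derivative A 0 0 t * y0 t + A 0 1 t * y1 t + A 0 2 t * y2 t
      + A 0 3 t * y3 t) (at t)"
    "\<And>t. (y1 has_real_derivative A 1 0 t * y0 t + A 1 1 t * y1 t + A 1 2 t * y2 t
        + A 1 3 t * y3 t) (at t)"
    "\<And>t. (y2 has_real_derivative A 2 0 t * y0 t + A 2 1 t * y1 t + A 2 2 t * y2 t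
        + A 2 3 t * y3 t) (at t)"
    "\<And>t. (y3 has_real_derivative A 3 0 t * y0 t + A 3 1 t * y1 t + A 3 2 t * y2 t
        + A 3 3 t * y3 t) (at t)"
    and cont: "\<And>i j. continuous_on UNIV (A i j)"
    and "y0 0 = 0" "y1 0 = 0" "y2 0 = 0" "y3 0 = 0"
  shows "y0 t = 0" "y1 t = 0" "y2 t = 0" "y3 t = 0"
proof -
  define y where "y i = (if i = 0 then y0 else if i = 1 then y1 else if i = 2 then y2 else y3)"
      for i :: nat
  have "y i t = 0" if "i \<in> {0,1,2,3}" for i
    using that assms by (intro linear_ode_zero[of "{0,1,2,3}" y A i]) (auto simp: y_def add.assoc)
  from this[of 0] this[of 1] this[of 2] this[of 3]
  show "y0 t = 0" "y1 t = 0" "y2 t = 0" "y3 t = 0" by (simp_all add: y_def)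
qed

lemma partial_xi_2_eq_0D:
  assumes "partial_xi 2 F = 0"
  shows "component F {2} = (\<lambda>_. 0)" "component F {0,2} = (\<lambda>_. 0)" "component F {1,2} = (\<lambda>_. 0)"
    "component F {0,1,2} = (\<lambda>_. 0)"
  using arg_cong[OF assms, of "\<lambda>F. component F {}"] arg_cong[OF assms, of "\<lambda>F. component F {0}"]
    arg_cong[OF assms, of "\<lambda>F. component F {1}"] arg_cong[OF assms, of "\<lambda>F. component F {0,1}"]
  by (simp_all add: fun_eq_iff)

lemma continuous_component: "continuous_on S (component F I)"
  using deriv_component by (meson DERIV_isCont continuous_at_imp_continuous_on)

lemma continuous_deriv_component: "continuous_on S (deriv (component F I))"
  using continuous_component[of S "partial_x F"] by simp

lemma continuous_deriv2_component: "continuous_on S (deriv (deriv (component F I)))"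
  using continuous_component[of S "partial_x (partial_x F)"] by simp

lemma deriv2_component: "(deriv (component F I) has_real_derivative deriv (deriv (component F I)) t)
    (at t)"
  using deriv_component[of "partial_x F"] by simp

lemma continuous_on_if_const:
  "continuous_on S f \<Longrightarrow> continuous_on S g \<Longrightarrow> continuous_on S (\<lambda>t. if b then f t else g t)"
  by (cases b) simp_all

text \<open>
  Here \<open>P = p\<close>, \<open>U = u a\<close>, and \<open>v\<close>, \<open>w\<close> are the coefficients of \<open>b\<close> in \<open>V\<close>, \<open>W\<close>.
  The equations for \<open>V\<close> and \<open>W\<close> give \<open>p' = u - v\<close>, \<open>v' = w - u'\<close>, the coefficient of \<open>c\<close>
  in \<open>X G = D W - (D P) G\<close> then gives \<open>u'\<close>, and the coefficient of \<open>b\<close> gives \<open>w'\<close>.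
\<close>

lemma even_symmetry_eq_zero:
  assumes X: "X \<in> symmetry_space 0 G" and G: "odd_superfun G"
    and init: "component (X coord) {} 0 = 0" "component (X (xi 0)) {0} 0 = 0"
      "component (X (xi 1)) {1} 0 = 0" "component (X (xi 2)) {1} 0 = 0"
  shows "X = 0"
proof -
  define P U V W where PUVW: "P = X coord" "U = X (xi 0)" "V = X (xi 1)" "W = X (xi 2)"
  have sd: "superderivation 0 X" using X by (simp add: symmetry_space_def)
  have hom: "homogeneous 0 P" "homogeneous 1 U" "homogeneous 1 V" "homogeneous 1 W"
    using superderivation_homogeneous[OF sd homogeneous_body]
        superderivation_homogeneous[OF sd homogeneous_xi]
    by (simp_all add: PUVW coord_def)
  note [simp] = homogeneous_evenD[OF hom(1), simplified] homogeneous_oddD[OF hom(2), simplified]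
    homogeneous_oddD[OF hom(3), simplified] homogeneous_oddD[OF hom(4), simplified]
    homogeneous_oddD[OF G, simplified]
  note eqs = symmetry_equations[OF X, folded PUVW]
  note [simp] = partial_xi_2_eq_0D[OF eqs(4)] partial_xi_2_eq_0D[OF eqs(5)]
      partial_xi_2_eq_0D[OF eqs(6)]
  have XG: "X G = vector_field P U V W G"
    unfolding PUVW by (rule fun_cong[OF superderivation_eq_vector_field[OF sd]])
  note expand = total_derivative_def vector_field_def component_times
  have eq: "component V I t = component (total_derivative G U - total_derivative G P * xi 1) I t"
    "component W I t = component (total_derivative G V - total_derivative G P * xi 2) I t"
    "component (vector_field P U V W G) I t
        = component (total_derivative G W - total_derivative G P * G) I t" for I t
    using eqs(1-3) XG by simp_all
  \<comment> \<open>In \<open>V = D U - (D P) b\<close> the coefficients of \<open>c\<close> and of \<open>a b c\<close> must vanish.\<close>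
  have U1 [simp]: "component U {1} = (\<lambda>_. 0)"
    using eq(1)[of "{2}"] by (simp add: expand fun_eq_iff)
  have P01 [simp]: "component P {0,1} = (\<lambda>_. 0)"
    using eq(1)[of "{0,1,2}"] by (simp add: expand fun_eq_iff)
  define p u v w where puvw: "p = component P {}" "u = component U {0}" "v = component V {1}"
      "w = component W {1}"
  define g1 g2 where g: "g1 = component G {1}" "g2 = component G {2}"
  have D: "(p has_real_derivative deriv p t) (at t)" "(u has_real_derivative deriv u t) (at t)"
    "(v has_real_derivative deriv v t) (at t)" "(w has_real_derivative deriv w t) (at t)"
    "(g1 has_real_derivative deriv g1 t) (at t)"
    "(g2 has_real_derivative deriv g2 t) (at t)"
    "(deriv g2 has_real_derivative deriv (deriv g2) t) (at t)" for t
    by (simp_all add: puvw g deriv_component deriv2_component)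
  have V0: "component V {0} t = deriv u t" for t
    using eq(1)[of "{0}" t] by (simp add: expand puvw)
  have p': "deriv p t = u t - v t" for t
    using eq(1)[of "{1}" t] by (simp add: expand puvw)
  have W0: "component W {0} t = deriv (component V {0}) t" for t
    using eq(2)[of "{0}" t] by (simp add: expand puvw)
  have v': "deriv v t = w t - deriv u t" for t
    using eq(2)[of "{1}" t] by (simp add: expand puvw V0)
  have W2: "component W {2} = (\<lambda>t. 2 * v t - u t)"
    using eq(2)[of "{2}"] by (simp add: expand puvw[symmetric] p' fun_eq_iff)
  have W2': "deriv (component W {2}) t = 2 * deriv v t - deriv u t" for t
    unfolding W2 by (rule DERIV_imp_deriv) (auto intro!: derivative_eq_intros D)
  have u': "deriv u t = w t - ((u t - v t) * g2 t + p t * deriv g2 t) / 3" for t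
    using eq(3)[of "{2}" t] by (simp add: expand puvw[symmetric] g[symmetric] p' W2' v')
      (simp add: field_simps W2)
  \<comment> \<open>The coefficient of \<open>a\<close> in \<open>W\<close> is the derivative of that in \<open>V\<close>, which is \<open>u'\<close>;
      so \<open>w'\<close> enters through \<open>u''\<close>.\<close>
  have "component V {0} = (\<lambda>t. w t - ((u t - v t) * g2 t + p t * deriv g2 t) / 3)"
    by (simp add: fun_eq_iff V0 u')
  then have "deriv (component V {0}) t
      = deriv w t - ((deriv u t - deriv v t) * g2 t + (u t - v t) * deriv g2 t
      + (u t - v t) * deriv g2 t + p t * deriv (deriv g2) t) / 3" for t
    by (simp only:, intro DERIV_imp_deriv)
        (auto intro!: derivative_eq_intros D simp: p' field_simps)
  then have w': "deriv w t = (g1 t - (g2 t)\<^sup>2 / 9 + deriv g2 t / 3) * (u t - v t)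
      + (deriv g1 t / 2 - g2 t * deriv g2 t / 9 + deriv (deriv g2) t / 6) * p t + 2 / 3 * g2 t * w
          t" for t
    using eq(3)[of "{1}" t] by (simp add: expand puvw[symmetric] g[symmetric] p' W0)
      (simp add: u' v' W2 field_simps power2_eq_square)
  define A :: "nat \<Rightarrow> nat \<Rightarrow> real \<Rightarrow> real" where "A i j t =
    (if i = 0 then (if j = 1 then 1 else if j = 2 then - 1 else 0)
     else if i = 1 then (if j = 0 then - deriv g2 t / 3 else if j = 1 then - g2 t / 3
       else if j = 2 then g2 t / 3 else 1)
     else if i = 2 then (if j = 0 then deriv g2 t / 3 else if j = 1 then g2 t / 3
       else if j = 2 then - g2 t / 3 else 0)
     else if j = 0 then deriv g1 t / 2 - g2 t * deriv g2 t / 9 + deriv (deriv g2) t / 6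
     else if j = 1 then g1 t - (g2 t)\<^sup>2 / 9 + deriv g2 t / 3
     else if j = 2 then - (g1 t - (g2 t)\<^sup>2 / 9 + deriv g2 t / 3)
     else 2 / 3 * g2 t)" for i j t
  have cont: "continuous_on UNIV (A i j)" for i j
    unfolding A_def[abs_def] g
    by (rule continuous_on_if_const | intro continuous_intros continuous_component
        continuous_deriv_component continuous_deriv2_component | simp)+
  have system:
    "(p has_real_derivative A 0 0 t * p t + A 0 1 t * u t + A 0 2 t * v t + A 0 3 t * w t) (at t)"
    "(u has_real_derivative A 1 0 t * p t + A 1 1 t * u t + A 1 2 t * v t + A 1 3 t * w t) (at t)"
    "(v has_real_derivative A 2 0 t * p t + A 2 1 t * u t + A 2 2 t * v t + A 2 3 t * w t) (at t)"
    "(w has_real_derivative A 3 0 t * p t + A 3 1 t * u t + A 3 2 t * v t + A 3 3 t * w t) (at t)"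
    for t
    by (rule DERIV_cong[OF D(1)] DERIV_cong[OF D(2)] DERIV_cong[OF D(3)] DERIV_cong[OF D(4)];
        simp add: A_def p' v' u' w'; (simp add: field_simps)?)+
  have "p 0 = 0" "u 0 = 0" "v 0 = 0" "w 0 = 0"
    using init by (simp_all add: PUVW puvw)
  note zero = linear_ode4_zero(1,2)[OF system cont this]
  have "P = 0" "U = 0"
    using zero by (auto intro!: superfun_eqI simp: puvw fun_eq_iff)
  then show ?thesis
    using symmetry_eq_zero[OF X G] by (simp add: PUVW)
qed

text \<open>
  Here \<open>P = q a\<close>, \<open>U = r\<close>, and \<open>s\<close>, \<open>w\<close> are the terms of \<open>V\<close>, \<open>W\<close> without odd
  coordinates.  The equations for \<open>V\<close> and \<open>W\<close> give \<open>r' = s\<close>, \<open>s' = w\<close>.  In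
  \<open>X G = D W - (D P) G\<close> the term without odd coordinates gives \<open>w'\<close>, and the coefficient of
  \<open>b c\<close> gives \<open>q'\<close>.
\<close>

lemma odd_symmetry_eq_zero:
  assumes X: "X \<in> symmetry_space 1 G" and G: "odd_superfun G"
    and init: "component (X coord) {0} 0 = 0" "component (X (xi 0)) {} 0 = 0"
      "component (X (xi 1)) {} 0 = 0" "component (X (xi 2)) {} 0 = 0"
  shows "X = 0"
proof -
  define P U V W where PUVW: "P = X coord" "U = X (xi 0)" "V = X (xi 1)" "W = X (xi 2)"
  have sd: "superderivation 1 X" using X by (simp add: symmetry_space_def)
  have hom: "homogeneous 1 P" "homogeneous 2 U" "homogeneous 2 V" "homogeneous 2 W"
    using superderivation_homogeneous[OF sd homogeneous_body]
        superderivation_homogeneous[OF sd homogeneous_xi]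
    by (simp_all add: PUVW coord_def)
  note [simp] = homogeneous_oddD[OF hom(1), simplified] homogeneous_evenD[OF hom(2), simplified]
    homogeneous_evenD[OF hom(3), simplified] homogeneous_evenD[OF hom(4), simplified]
    homogeneous_oddD[OF G, simplified]
  note eqs = symmetry_equations[OF X, folded PUVW]
  note [simp] = partial_xi_2_eq_0D[OF eqs(4)] partial_xi_2_eq_0D[OF eqs(5)]
      partial_xi_2_eq_0D[OF eqs(6)]
  have XG: "X G = vector_field P U V W G"
    unfolding PUVW by (rule fun_cong[OF superderivation_eq_vector_field[OF sd]])
  note expand = total_derivative_def vector_field_def component_times
  have eq: "component V I t = component (total_derivative G U - total_derivative G P * xi 1) I t"
    "component W I t = component (total_derivative G V - total_derivative G P * xi 2) I t"
    "component (vector_field P U V W G) I t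
        = component (total_derivative G W - total_derivative G P * G) I t" for I t
    using eqs(1-3) XG by simp_all
  \<comment> \<open>In \<open>V = D U - (D P) b\<close> the coefficients of \<open>b c\<close> and of \<open>a c\<close> must vanish.\<close>
  have P1 [simp]: "component P {1} = (\<lambda>_. 0)"
    using eq(1)[of "{1,2}"] by (simp add: expand fun_eq_iff)
  have U01 [simp]: "component U {0,1} = (\<lambda>_. 0)"
    using eq(1)[of "{0,2}"] by (simp add: expand fun_eq_iff)
  define q r s w where qrsw: "q = component P {0}" "r = component U {}" "s = component V {}"
      "w = component W {}"
  define g0 g1 g2 g3 where g: "g0 = component G {0}" "g1 = component G {1}" "g2 = component G {2}"
      "g3 = component G {0,1,2}"
  have D: "(q has_real_derivative deriv q t) (at t)" "(r has_real_derivative deriv r t) (at t)"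
    "(s has_real_derivative deriv s t) (at t)" "(w has_real_derivative deriv w t) (at t)" for t
    by (simp_all add: qrsw deriv_component)
  have r': "deriv r t = s t" for t
    using eq(1)[of "{}" t] by (simp add: expand qrsw)
  have s': "deriv s t = w t" for t
    using eq(2)[of "{}" t] by (simp add: expand qrsw)
  have w': "deriv w t = g0 t * r t + g1 t * s t + g2 t * w t" for t
    using eq(3)[of "{}" t] by (simp add: expand qrsw g algebra_simps)
  have V01: "component V {0,1} t = - deriv q t" for t
    using eq(1)[of "{0,1}" t] by (simp add: expand qrsw)
  have W02: "component W {0,2} t = - 2 * deriv q t" for t
    using eq(2)[of "{0,2}" t] by (simp add: expand qrsw V01)
  have W12: "component W {1,2} = (\<lambda>t. - q t)"
    using eq(2)[of "{1,2}"] by (simp add: expand qrsw fun_eq_iff)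
  have W12': "deriv (component W {1,2}) t = - deriv q t" for t
    unfolding W12 by (rule DERIV_imp_deriv) (auto intro!: derivative_eq_intros D)
  have q': "deriv q t = - (q t * g2 t + g3 t * r t) / 3" for t
    using eq(3)[of "{1,2}" t] by (simp add: expand qrsw[symmetric] g[symmetric] W12')
      (simp add: W12 W02 field_simps)
  define A :: "nat \<Rightarrow> nat \<Rightarrow> real \<Rightarrow> real" where "A i j t =
    (if i = 0 then (if j = 0 then - g2 t / 3 else if j = 1 then - g3 t / 3 else 0)
     else if i = 1 then (if j = 2 then 1 else 0)
     else if i = 2 then (if j = 3 then 1 else 0)
     else if j = 0 then 0 else if j = 1 then g0 t else if j = 2 then g1 t else g2 t)" for i j t
  have cont: "continuous_on UNIV (A i j)" for i j
    unfolding A_def[abs_def] g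
    by (rule continuous_on_if_const | intro continuous_intros continuous_component | simp)+
  have system:
    "(q has_real_derivative A 0 0 t * q t + A 0 1 t * r t + A 0 2 t * s t + A 0 3 t * w t) (at t)"
    "(r has_real_derivative A 1 0 t * q t + A 1 1 t * r t + A 1 2 t * s t + A 1 3 t * w t) (at t)"
    "(s has_real_derivative A 2 0 t * q t + A 2 1 t * r t + A 2 2 t * s t + A 2 3 t * w t) (at t)"
    "(w has_real_derivative A 3 0 t * q t + A 3 1 t * r t + A 3 2 t * s t + A 3 3 t * w t) (at t)"
    for t
    by (rule DERIV_cong[OF D(1)] DERIV_cong[OF D(2)] DERIV_cong[OF D(3)] DERIV_cong[OF D(4)];
        simp add: A_def q' r' s' w'; (simp add: field_simps)?)+
  have "q 0 = 0" "r 0 = 0" "s 0 = 0" "w 0 = 0"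
    using init by (simp_all add: PUVW qrsw)
  note zero = linear_ode4_zero(1,2)[OF system cont this]
  have "P = 0" "U = 0"
    using zero by (auto intro!: superfun_eqI simp: qrsw fun_eq_iff)
  then show ?thesis
    using symmetry_eq_zero[OF X G] by (simp add: PUVW)
qed

lemma
  assumes G: "odd_superfun G"
  shows fin_dim_even_symmetries: "fin_dim (symmetry_space 0 G)"
    and dim_even_symmetries_le: "dim (symmetry_space 0 G) \<le> 4"
proof -
  define \<Phi> :: "operator \<Rightarrow> real \<times> real \<times> real \<times> real" where
    "\<Phi> X = (component (X coord) {} 0, component (X (xi 0)) {0} 0, component (X (xi 1)) {1} 0,
        component (X (xi 2)) {1} 0)" for X
  have "linear \<Phi>"
    by (rule linearI) (simp_all add: \<Phi>_def scaleR_fun_def)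
  moreover have "X = 0" if "X \<in> symmetry_space 0 G" "\<Phi> X = 0" for X
    using even_symmetry_eq_zero[OF that(1) G] that(2) by (simp add: \<Phi>_def zero_prod_def)
  ultimately show "fin_dim (symmetry_space 0 G)" "dim (symmetry_space 0 G) \<le> 4"
    using fin_dim_dim_le_of_injective[OF subspace_symmetry_space[OF G], of \<Phi> 0 "symmetry_space 0 G"]
        by simp_all
qed

lemma
  assumes G: "odd_superfun G"
  shows fin_dim_odd_symmetries: "fin_dim (symmetry_space 1 G)"
    and dim_odd_symmetries_le: "dim (symmetry_space 1 G) \<le> 4"
proof -
  define \<Phi> :: "operator \<Rightarrow> real \<times> real \<times> real \<times> real" where
    "\<Phi> X = (component (X coord) {0} 0, component (X (xi 0)) {} 0, component (X (xi 1)) {} 0,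
        component (X (xi 2)) {} 0)" for X
  have "linear \<Phi>"
    by (rule linearI) (simp_all add: \<Phi>_def scaleR_fun_def)
  moreover have "X = 0" if "X \<in> symmetry_space 1 G" "\<Phi> X = 0" for X
    using odd_symmetry_eq_zero[OF that(1) G] that(2) by (simp add: \<Phi>_def zero_prod_def)
  ultimately show "fin_dim (symmetry_space 1 G)" "dim (symmetry_space 1 G) \<le> 4"
    using fin_dim_dim_le_of_injective[OF subspace_symmetry_space[OF G], of \<Phi> 1 "symmetry_space 1 G"]
        by simp_all
qed

section \<open>The symmetries of \<open>\<xi>''' = 0\<close>\<close>

text \<open>
  Both sides of \<open>[X, D] = h D\<close> are superderivations of parity \<open>p\<close>, and both sides of
  \<open>[X, \<partial>\<^sub>c] = k \<partial>\<^sub>c\<close> of parity \<open>p + 1\<close>, so agreement on the coordinates is enough.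
\<close>

lemma symmetry_spaceI:
  assumes G: "odd_superfun G" and X: "superderivation p X"
    and h: "homogeneous p h" "\<And>F. F \<in> {coord, xi 0, xi 1, xi 2} \<Longrightarrow>
      X (total_derivative G F) - total_derivative G (X F) = h * total_derivative G F"
    and k: "homogeneous p k" "\<And>F. F \<in> {coord, xi 0, xi 1, xi 2} \<Longrightarrow>
      X (partial_xi 2 F) - (-1) ^ p * partial_xi 2 (X F) = k * partial_xi 2 F"
  shows "X \<in> symmetry_space p G"
proof -
  have le_2: "j = 0 \<or> j = 1 \<or> j = 2" if "j \<le> 2" for j :: nat
    using that by linarith
  note D = superderivation_total_derivative[OF G] and V =
      superderivation_partial_xi[of 2, simplified]
  have "superderivation (p + 0) (\<lambda>F. X (total_derivative G F)
      - (-1) ^ (p * 0) * total_derivative G (X F))"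
    by (rule superderivation_superbracket[OF X D])
  then have "(\<lambda>F. X (total_derivative G F) - total_derivative G (X F))
      = (\<lambda>F. h * total_derivative G F)"
    using superderivation_left_mult[OF h(1) D] h(2)[of coord] h(2)[of "xi 0"] h(2)[of "xi 1"]
        h(2)[of "xi 2"]
    by (intro superderivation_eqI[where p = p]) (auto dest!: le_2)
  moreover have "superderivation (p + 1) (\<lambda>F. X (partial_xi 2 F)
      - (-1) ^ (p * 1) * partial_xi 2 (X F))"
    by (rule superderivation_superbracket[OF X V])
  then have "(\<lambda>F. X (partial_xi 2 F) - (-1) ^ p * partial_xi 2 (X F)) = (\<lambda>F. k * partial_xi 2 F)"
    using superderivation_left_mult[OF k(1) V] k(2)[of coord] k(2)[of "xi 0"] k(2)[of "xi 1"]
        k(2)[of "xi 2"]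
    by (intro superderivation_eqI[where p = "p + 1"]) (auto dest!: le_2)
  ultimately show ?thesis
    using X unfolding symmetry_space_def by (auto dest: fun_cong)
qed

text \<open>
  The prolongation of \<open>p \<partial>\<^sub>x + (p' + d) \<xi> \<partial>\<^sub>\<xi>\<close> with \<open>p = a + b x + c x\<^sup>2\<close>.
\<close>

definition flat_even_symmetry :: "real \<times> real \<times> real \<times> real \<Rightarrow> operator" where
  "flat_even_symmetry = (\<lambda>(a, b, c, d). vector_field
     (body (\<lambda>t. a + b * t + c * t\<^sup>2))
     (body (\<lambda>t. b + d + 2 * c * t) * xi 0)
     ((2 * c) *\<^sub>R xi 0 + d *\<^sub>R xi 1)
     ((2 * c) *\<^sub>R xi 1 + body (\<lambda>t. d - b - 2 * c * t) * xi 2))"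

text \<open>
  The prolongation of \<open>d \<xi> \<partial>\<^sub>x + r \<partial>\<^sub>\<xi>\<close> with \<open>r = a + b x + c x\<^sup>2\<close>.
\<close>

definition flat_odd_symmetry :: "real \<times> real \<times> real \<times> real \<Rightarrow> operator" where
  "flat_odd_symmetry = (\<lambda>(a, b, c, d). vector_field
     (d *\<^sub>R xi 0) (body (\<lambda>t. a + b * t + c * t\<^sup>2)) (body (\<lambda>t. b + 2 * c * t))
     ((2 * c) *\<^sub>R 1 - d *\<^sub>R (xi 1 * xi 2)))"

lemma smooth_quadratic [simp]: "smooth (\<lambda>t. a + b * t + c * t\<^sup>2)" "smooth (\<lambda>t. a + b * t)"
    "smooth (\<lambda>t. a - b * t)"
  unfolding power2_eq_square
      by (intro smooth_add smooth_diff smooth_mult smooth_const smooth_ident)+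

lemma deriv_quadratic [simp]:
  fixes a b c :: real
  shows "deriv (\<lambda>t. a + b * t + c * t\<^sup>2) = (\<lambda>t. b + 2 * c * t)"
  "deriv (\<lambda>t. a + b * t) = (\<lambda>t. b)" "deriv (\<lambda>t. a - b * t) = (\<lambda>t. - b)"
  by (auto simp: fun_eq_iff intro!: DERIV_imp_deriv derivative_eq_intros)

lemma vector_field_linear:
  "vector_field (P + P') (U + U') (V + V') (W + W')
      = vector_field P U V W + vector_field P' U' V' W'"
  "vector_field (r *\<^sub>R P) (r *\<^sub>R U) (r *\<^sub>R V) (r *\<^sub>R W) = r *\<^sub>R vector_field P U V W"
  by (simp_all add: vector_field_def fun_eq_iff scaleR_fun_def algebra_simps)

lemma vector_field_eq_0_iff: "vector_field P U V W = 0 \<longleftrightarrow> P = 0 \<and> U = 0 \<and> V = 0 \<and> W = 0"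
proof
  assume H: "vector_field P U V W = 0"
  show "P = 0 \<and> U = 0 \<and> V = 0 \<and> W = 0"
    using fun_cong[OF H, of coord] fun_cong[OF H, of "xi 0"] fun_cong[OF H, of "xi 1"]
        fun_cong[OF H, of "xi 2"]
    by simp
qed (simp add: vector_field_def zero_fun_def)

lemma flat_even_symmetry: "flat_even_symmetry v \<in> symmetry_space 0 0"
proof -
  obtain a b c d where v: "v = (a, b, c, d)" by (cases v)
  \<comment> \<open>\<open>h = - D P\<close> and \<open>k = - \<partial>\<^sub>c W\<close>, as the conditions on \<open>x\<close> and on \<open>c\<close> require.\<close>
  define h k where "h = - body (\<lambda>t. b + 2 * c * t)" and "k = - body (\<lambda>t. d - b - 2 * c * t)"
  have sm: "smooth (\<lambda>t. d - b - 2 * c * t)" "smooth (\<lambda>t. b + d + 2 * c * t)"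
      by (rule smooth_quadratic)+
  show ?thesis
  proof (rule symmetry_spaceI[where h = h and k = k])
    show "superderivation 0 (flat_even_symmetry v)"
      unfolding flat_even_symmetry_def v prod.case
      using sm by (intro superderivation_vector_field)
          (simp_all add: homogeneous_iff component_times)
    show "homogeneous 0 h" "homogeneous 0 k"
      using sm by (simp_all add: homogeneous_iff h_def k_def)
    show "flat_even_symmetry v (total_derivative 0 F) - total_derivative 0 (flat_even_symmetry v F)
        = h * total_derivative 0 F" if "F \<in> {coord, xi 0, xi 1, xi 2}" for F
      using that sm unfolding flat_even_symmetry_def v prod.case
      by (elim insertE; simp; intro superfun_eqI;
          simp add: total_derivative_def vector_field_def component_times h_def k_def coord_def;
          (simp add: algebra_simps)?)
    show "flat_even_symmetry v (partial_xi 2 F) - (-1) ^ 0 * partial_xi 2 (flat_even_symmetry v F)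
        = k * partial_xi 2 F" if "F \<in> {coord, xi 0, xi 1, xi 2}" for F
      using that sm unfolding flat_even_symmetry_def v prod.case
      by (elim insertE; simp; intro superfun_eqI;
          simp add: total_derivative_def vector_field_def component_times h_def k_def coord_def;
          (simp add: algebra_simps)?)
  qed simp
qed

lemma flat_odd_symmetry: "flat_odd_symmetry v \<in> symmetry_space 1 0"
proof -
  obtain a b c d where v: "v = (a, b, c, d)" by (cases v)
  \<comment> \<open>\<open>h = - D P\<close> and \<open>k = \<partial>\<^sub>c W\<close>, as the conditions on \<open>x\<close> and on \<open>c\<close> require.\<close>
  define h k where "h = - (d *\<^sub>R xi 1)" and "k = d *\<^sub>R xi 1"
  show ?thesis
  proof (rule symmetry_spaceI[where h = h and k = k])
    show "superderivation 1 (flat_odd_symmetry v)"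
      unfolding flat_odd_symmetry_def v prod.case
      by (intro superderivation_vector_field) (simp_all add: homogeneous_iff component_times)
    show "homogeneous 1 h" "homogeneous 1 k"
      by (simp_all add: homogeneous_iff h_def k_def)
    show "flat_odd_symmetry v (total_derivative 0 F) - total_derivative 0 (flat_odd_symmetry v F)
        = h * total_derivative 0 F" if "F \<in> {coord, xi 0, xi 1, xi 2}" for F
      using that unfolding flat_odd_symmetry_def v prod.case
      by (elim insertE; simp; intro superfun_eqI;
          simp add: total_derivative_def vector_field_def component_times h_def k_def coord_def;
          (simp add: algebra_simps)?)
    show "flat_odd_symmetry v (partial_xi 2 F) - (-1) ^ 1 * partial_xi 2 (flat_odd_symmetry v F)
        = k * partial_xi 2 F" if "F \<in> {coord, xi 0, xi 1, xi 2}" for F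
      using that unfolding flat_odd_symmetry_def v prod.case
      by (elim insertE; simp; intro superfun_eqI;
          simp add: total_derivative_def vector_field_def component_times h_def k_def coord_def;
          (simp add: algebra_simps)?)
  qed simp
qed

lemma linear_flat_even_symmetry: "linear flat_even_symmetry"
  and inj_flat_even_symmetry: "inj flat_even_symmetry"
proof -
  show lin: "linear flat_even_symmetry"
  proof (rule linearI)
    fix v v' show "flat_even_symmetry (v + v') = flat_even_symmetry v + flat_even_symmetry v'"
      unfolding flat_even_symmetry_def split_beta vector_field_linear(1)[symmetric]
      by (rule arg_cong4[where f = vector_field]; intro superfun_eqI;
        simp add: component_times; (simp add: algebra_simps)?)
    fix r show "flat_even_symmetry (r *\<^sub>R v) = r *\<^sub>R flat_even_symmetry v"
      unfolding flat_even_symmetry_def split_beta vector_field_linear(2)[symmetric]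
      by (rule arg_cong4[where f = vector_field]; intro superfun_eqI;
        simp add: component_times; (simp add: algebra_simps)?)
  qed
  show "inj flat_even_symmetry"
    unfolding linear_injective_0[OF lin]
  proof (intro allI impI)
    fix v assume v: "flat_even_symmetry v = 0"
    obtain a b c d where v': "v = (a, b, c, d)" by (cases v)
    have P: "body (\<lambda>t. a + b * t + c * t\<^sup>2) = 0" and V: "(2 * c) *\<^sub>R xi 0 + d *\<^sub>R xi 1 = 0"
      using v unfolding flat_even_symmetry_def v' prod.case vector_field_eq_0_iff by blast+
    have "(\<lambda>t. a + b * t + c * t\<^sup>2) = (\<lambda>_. 0)"
      using arg_cong[OF P, of "\<lambda>F. component F {}"] by simp
    \<comment> \<open>A quadratic polynomial with zeros at \<open>0\<close>, \<open>1\<close>, \<open>-1\<close> is zero.\<close>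
    from fun_cong[OF this, of 0] fun_cong[OF this, of 1] fun_cong[OF this, of "-1"] have "a = 0"
        "b = 0" "c = 0"
      by simp_all
    moreover have "d = 0"
      using arg_cong[OF V, of "\<lambda>F. component F {1}"] by (simp add: fun_eq_iff)
    ultimately show "v = 0" by (simp add: v' zero_prod_def)
  qed
qed

lemma linear_flat_odd_symmetry: "linear flat_odd_symmetry"
  and inj_flat_odd_symmetry: "inj flat_odd_symmetry"
proof -
  show lin: "linear flat_odd_symmetry"
  proof (rule linearI)
    fix v v' show "flat_odd_symmetry (v + v') = flat_odd_symmetry v + flat_odd_symmetry v'"
      unfolding flat_odd_symmetry_def split_beta vector_field_linear(1)[symmetric]
      by (rule arg_cong4[where f = vector_field]; intro superfun_eqI;
        simp add: component_times; (simp add: algebra_simps)?)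
    fix r show "flat_odd_symmetry (r *\<^sub>R v) = r *\<^sub>R flat_odd_symmetry v"
      unfolding flat_odd_symmetry_def split_beta vector_field_linear(2)[symmetric]
      by (rule arg_cong4[where f = vector_field]; intro superfun_eqI;
        simp add: component_times; (simp add: algebra_simps)?)
  qed
  show "inj flat_odd_symmetry"
    unfolding linear_injective_0[OF lin]
  proof (intro allI impI)
    fix v assume v: "flat_odd_symmetry v = 0"
    obtain a b c d where v': "v = (a, b, c, d)" by (cases v)
    have U: "body (\<lambda>t. a + b * t + c * t\<^sup>2) = 0" and P: "d *\<^sub>R xi 0 = 0"
      using v unfolding flat_odd_symmetry_def v' prod.case vector_field_eq_0_iff by blast+
    have "(\<lambda>t. a + b * t + c * t\<^sup>2) = (\<lambda>_. 0)"
      using arg_cong[OF U, of "\<lambda>F. component F {}"] by simp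
    from fun_cong[OF this, of 0] fun_cong[OF this, of 1] fun_cong[OF this, of "-1"] have "a = 0"
        "b = 0" "c = 0"
      by simp_all
    moreover have "d = 0"
      using arg_cong[OF P, of "\<lambda>F. component F {0}"] by (simp add: fun_eq_iff)
    ultimately show "v = 0" by (simp add: v' zero_prod_def)
  qed
qed

section \<open>The dimension bound and its sharpness\<close>

theorem theorem5p10:
  shows "(\<forall>G. odd_superfun G \<longrightarrow>
            fin_dim (even_fields (contact_symmetries G)) \<and>
            fin_dim (odd_fields (contact_symmetries G)) \<and>
            dim (even_fields (contact_symmetries G)) \<le> 4 \<and>
            dim (odd_fields (contact_symmetries G)) \<le> 4)
       \<and> (\<exists>G. odd_superfun G \<and>
            fin_dim (even_fields (contact_symmetries G)) \<and>
            fin_dim (odd_fields (contact_symmetries G)) \<and>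
            dim (even_fields (contact_symmetries G)) = 4 \<and>
            dim (odd_fields (contact_symmetries G)) = 4)"
proof (intro conjI allI impI exI[of _ 0])
  note bounds = fin_dim_even_symmetries dim_even_symmetries_le fin_dim_odd_symmetries
      dim_odd_symmetries_le
  fix G assume "odd_superfun G"
  then show "fin_dim (even_fields (contact_symmetries G))"
      "fin_dim (odd_fields (contact_symmetries G))"
    "dim (even_fields (contact_symmetries G)) \<le> 4" "dim (odd_fields (contact_symmetries G)) \<le> 4"
    by (simp_all add: symmetry_space_0 symmetry_space_1 bounds)
next
  have "dim (symmetry_space 0 0) \<ge> 4"
    using dim_ge_of_injective[OF linear_flat_even_symmetry inj_flat_even_symmetry,
        of "symmetry_space 0 0"]
      flat_even_symmetry fin_dim_even_symmetries[OF homogeneous_0] by (simp add: image_subset_iff)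
  moreover have "dim (symmetry_space 1 0) \<ge> 4"
    using dim_ge_of_injective[OF linear_flat_odd_symmetry inj_flat_odd_symmetry,
        of "symmetry_space 1 0"]
      flat_odd_symmetry fin_dim_odd_symmetries[OF homogeneous_0] by (simp add: image_subset_iff)
  ultimately show "fin_dim (even_fields (contact_symmetries 0))"
      "fin_dim (odd_fields (contact_symmetries 0))"
    "dim (even_fields (contact_symmetries 0)) = 4" "dim (odd_fields (contact_symmetries 0)) = 4"
    using dim_even_symmetries_le[OF homogeneous_0] dim_odd_symmetries_le[OF homogeneous_0]
    by (simp_all add: symmetry_space_0 symmetry_space_1 fin_dim_even_symmetries
        fin_dim_odd_symmetries)
qed simp

end
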